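(* Let $E=\mathbb{R}^n$, let $I$ be a past interval, $H\subset\mathrm{Map}(I,E)$ a history space, and $F\colon\mathbb{R}\times H\supset\mathrm{dom}(F)\to E$ a map. Suppose that (i) $H$ is prolongable and regulated by prolongations, (ii) $F$ is continuous, and (iii) $\mathrm{dom}(F)$ is a uniform neighborhood by prolongations of every $(t_0,\phi_0)\in\mathrm{dom}(F)$. If $F$ is locally Lipschitzian about prolongations, and if the semiflow $$\mathbb{R}_+\times H\ni(t,\phi)\mapsto S_0(t)\phi\in H$$ is continuous, then the initial value problem $$\dot x(t)=F(t,I_tx)\quad(t\ge t_0),\qquad I_{t_0}x=\phi_0,\qquad(t_0,\phi_0)\in\mathrm{dom}(F),$$ is maximally well-posed for $C^1$-solutions.
   Context: Basic notation. $\mathbb{R}_+=[0,\infty)$, $\mathbb{R}_-=(-\infty,0]$. A past interval is an interval $I\subset\mathbb{R}_-$ with $0\in I$. $\mathrm{Map}(I,E)$ is the linear space of all maps $I\to E$; $\boldsymbol 0$ is the zero map. For an interval $J$, $J+I=\{t+\theta:t\in J,\theta\in I\}$. If $\gamma$ is an $E$-valued map defined on $J+I$ and $t\in J$, then $I_t\gamma\in\mathrm{Map}(I,E)$ is $I_t\gamma(\theta)=\gamma(t+\theta)$. A history space is a linear subspace $H\subset\mathrm{Map}(I,E)$ with a topology for which the linear operations are continuous. Prolongations. For $(\sigma,\psi)\in\mathbb{R}\times\mathrm{Map}(I,E)$, a prolongation of $(\sigma,\psi)$ is a map $\gamma\colon J+I\to E$, where $J$ is an interval with left end point $\sigma\in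 J$ ($J=\{\sigma\}$ allowed), with $I_\sigma\gamma=\psi$ and $\gamma|_J$ continuous. A prolongation of $\psi$ is one of $(0,\psi)$. $\bar\psi\colon\mathbb{R}_++I\to E$ is $\bar\psi(t)=\psi(t)$ for $t\in I$ and $\bar\psi(t)=\psi(0)$ for $t\ge0$. For $t\ge0$, $S_0(t)\phi:=I_t\bar\phi$. For $T\ge0$, $0\le\delta\le\infty$, $\varGamma_{\sigma,\psi}(T,\delta)$ is the set of prolongations $\gamma\colon[\sigma,\sigma+T]+I\to E$ of $(\sigma,\psi)$ with $\sup_{s\in[0,T]}\|\gamma(\sigma+s)-\psi(0)\|_E\le\delta$. The rectangle by prolongations is $$\varLambda_{\sigma,\psi}(T,\delta)=\bigcup_{\tau\in[0,T]}\{(\sigma+\tau,I_{\sigma+\tau}\gamma):\gamma\in\varGamma_{\sigma,\psi}(\tau,\delta)\}.$$ Properties of $H$. $H$ is prolongable if for every $\psi\in H$ and every prolongation $\gamma\colon\mathbb{R}_++I\to E$ of $\psi$ one has $I_t\gamma\in H$ for all $t\ge0$ and $t\mapsto I_t\gamma\in H$ is continuous on $\mathbb{R}_+$. $H$ is regulated by prolongations if for every $T>0$ and every neighborhood $N$ of $\boldsymbol 0$ in $H$ there is $\delta>0$ with $\varLambda_{0,\boldsymbol 0}(T,\delta)\subset[0,T]\times N$. $W\subset\mathbb{R}\times H$ is a uniform neighborhood by prolongations of $(\sigma_0,\psi_0)$ if there are $T,\delta>0$ and a neighborhood $W_0$ of $(\sigma_0,\psi_0)$ in $W$ with $\bigcup_{(\sigma,\psi)\in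 W_0}\varLambda_{\sigma,\psi}(T,\delta)\subset W$. Lipschitz condition. For $L>0$ and $(t,\phi_1),(t,\phi_2)\in\mathrm{dom}(F)$ with $\mathrm{supp}(\phi_1-\phi_2)$ compact, $L$-(Lip) is the inequality $\|F(t,\phi_1)-F(t,\phi_2)\|_E\le L\|\phi_1-\phi_2\|_\infty$ (sup norm over $I$). $F$ is locally Lipschitzian about prolongations if for every $(\sigma_0,\psi_0)\in\mathrm{dom}(F)$ there are $T,\delta,L>0$ such that $L$-(Lip) holds for all $(t,\phi_1),(t,\phi_2)\in\varLambda_{\sigma_0,\psi_0}(T,\delta)\cap\mathrm{dom}(F)$. Solutions. For $(t_0,\phi_0)\in\mathrm{dom}(F)$, a solution of the initial value problem is a map $x\colon J+I\to E$, $J$ a non-degenerate interval with left end point $t_0\in J$, such that $I_{t_0}x=\phi_0$, $(t,I_tx)\in\mathrm{dom}(F)$ for all $t\in J$, and $x|_J$ is differentiable with $(x|_J)'(t)=F(t,I_tx)$ for all $t\in J$. It is a $C^1$-solution if $x|_J$ is $C^1$. $C^1$-solutions $x_i\colon J_i+I\to E$ are partially ordered by: $x_1\le x_2$ iff $J_1\subset J_2$ and $x_1|_{J_1}=x_2|_{J_1}$; a maximal $C^1$-solution is a maximal element. Maximal well-posedness. A maximal semiflow in a topological space $X$ is a map $\varPhi\colon\mathbb{R}_+\times X\supset\mathrm{dom}(\varPhi)\to X$ such that (1) $\mathrm{dom}(\varPhi)=\bigcup_{x\in X}[0,T(x))\times\{x\}$ for some function $T\colon X\to(0,\infty]$; (2)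 $\varPhi(0,x)=x$; (3) if $(t_1,x)\in\mathrm{dom}(\varPhi)$ and $(t_2,\varPhi(t_1,x))\in\mathrm{dom}(\varPhi)$, then $(t_1+t_2,x)\in\mathrm{dom}(\varPhi)$ and $\varPhi(t_1+t_2,x)=\varPhi(t_2,\varPhi(t_1,x))$. It is a continuous maximal semiflow if moreover $\mathrm{dom}(\varPhi)$ is open in $\mathbb{R}_+\times X$ and $\varPhi$ is continuous. For $\varOmega\subset\mathbb{R}\times X$ (subspace topology), a map $\mathcal{P}\colon\mathbb{R}_+\times\varOmega\supset\mathrm{dom}(\mathcal{P})\to X$ is a continuous maximal process in $\varOmega$ if $\overline{\mathcal{P}}(\tau,(t,x))=(t+\tau,\mathcal{P}(\tau,t,x))$ on $\mathrm{dom}(\mathcal{P})$ defines a continuous maximal semiflow in $\varOmega$. The initial value problem is maximally well-posed for $C^1$-solutions if (1) for every $(t_0,\phi_0)\in\mathrm{dom}(F)$ there is a unique maximal $C^1$-solution $x_F(\cdot;t_0,\phi_0)\colon[t_0,t_0+T_F(t_0,\phi_0))+I\to E$ with $0<T_F(t_0,\phi_0)\le\infty$; and (2) the solution process $\mathcal{P}_F$, with $\mathrm{dom}(\mathcal{P}_F)=\bigcup_{(t_0,\phi_0)\in\mathrm{dom}(F)}[0,T_F(t_0,\phi_0))\times\{(t_0,\phi_0)\}$ and $\mathcal{P}_F(\tau,t_0,\phi_0)=I_{t_0+\tau}[x_F(\cdot;t_0,\phi_0)]\in H$, is a continuous maximal process in $\mathrm{dom}(F)$. *)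

theory Defs
  imports "HOL-Analysis.Analysis"
begin

section \<open>History spaces\<close>

text \<open>
  A map from a set \<open>A\<close> of reals to \<open>E\<close> is an element of \<open>extensional A\<close>, that is, a total function
  with the dummy value \<open>undefined\<close> outside \<open>A\<close>. Hence equality of such functions is equality
  of maps on \<open>A\<close>. The linear operations on the maps are restricted accordingly. The sum \<open>J + I\<close> of
  two sets is the Minkowski sum.
\<close>

definition past_interval :: "real set \<Rightarrow> bool" where
  "past_interval I \<longleftrightarrow> is_interval I \<and> I \<subseteq> {..0} \<and> 0 \<in> I"

definition zero_map :: "real set \<Rightarrow> real \<Rightarrow> 'e::real_normed_vector" where
  "zero_map I = (\<lambda>\<theta>\<in>I. 0)"

definition add_map :: "real set \<Rightarrow> (real \<Rightarrow> 'e::real_normed_vector) \<Rightarrow> (real \<Rightarrow> 'e) \<Rightarrow> real \<Rightarrow> 'e" where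
  "add_map I \<phi> \<psi> = (\<lambda>\<theta>\<in>I. \<phi> \<theta> + \<psi> \<theta>)"

definition scale_map :: "real set \<Rightarrow> real \<Rightarrow> (real \<Rightarrow> 'e::real_normed_vector) \<Rightarrow> real \<Rightarrow> 'e" where
  "scale_map I c \<phi> = (\<lambda>\<theta>\<in>I. c *\<^sub>R \<phi> \<theta>)"

definition shift_map :: "real set \<Rightarrow> real \<Rightarrow> (real \<Rightarrow> 'e::real_normed_vector) \<Rightarrow> real \<Rightarrow> 'e" where
  "shift_map I t \<gamma> = (\<lambda>\<theta>\<in>I. \<gamma> (t + \<theta>))"

text \<open>
  A history space is given by its topology \<open>H\<close>; the underlying linear space is \<open>topspace H\<close>.
  The topology need not be Hausdorff.
\<close>

definition history_space :: "real set \<Rightarrow> (real \<Rightarrow> 'e::real_normed_vector) topology \<Rightarrow> bool" where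
  "history_space I H \<longleftrightarrow>
     topspace H \<subseteq> extensional I \<and>
     zero_map I \<in> topspace H \<and>
     (\<forall>\<phi>\<in>topspace H. \<forall>\<psi>\<in>topspace H. add_map I \<phi> \<psi> \<in> topspace H) \<and>
     (\<forall>c. \<forall>\<phi>\<in>topspace H. scale_map I c \<phi> \<in> topspace H) \<and>
     continuous_map (prod_topology H H) H (\<lambda>(\<phi>, \<psi>). add_map I \<phi> \<psi>) \<and>
     continuous_map (prod_topology euclideanreal H) H (\<lambda>(c, \<phi>). scale_map I c \<phi>)"

text \<open>Neighborhoods are not required to be open.\<close>

definition nbhd_in :: "'a topology \<Rightarrow> 'a \<Rightarrow> 'a set \<Rightarrow> bool" where
  "nbhd_in X x N \<longleftrightarrow> N \<subseteq> topspace X \<and> (\<exists>U. openin X U \<and> x \<in> U \<and> U \<subseteq> N)"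

section \<open>Prolongations\<close>

definition interval_from :: "real \<Rightarrow> real set \<Rightarrow> bool" where
  "interval_from \<sigma> J \<longleftrightarrow> is_interval J \<and> \<sigma> \<in> J \<and> J \<subseteq> {\<sigma>..}"

definition prolongation ::
    "real set \<Rightarrow> real \<Rightarrow> (real \<Rightarrow> 'e::real_normed_vector) \<Rightarrow> real set \<Rightarrow> (real \<Rightarrow> 'e) \<Rightarrow> bool" where
  "prolongation I \<sigma> \<psi> J \<gamma> \<longleftrightarrow>
     interval_from \<sigma> J \<and> \<gamma> \<in> extensional (J + I) \<and> shift_map I \<sigma> \<gamma> = \<psi> \<and> continuous_on J \<gamma>"

definition const_prolongation :: "real set \<Rightarrow> (real \<Rightarrow> 'e::real_normed_vector) \<Rightarrow> real \<Rightarrow> 'e" where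
  "const_prolongation I \<psi> = (\<lambda>t\<in>{0..} + I. if t \<in> I then \<psi> t else \<psi> 0)"

definition S0 :: "real set \<Rightarrow> real \<Rightarrow> (real \<Rightarrow> 'e::real_normed_vector) \<Rightarrow> real \<Rightarrow> 'e" where
  "S0 I t \<phi> = shift_map I t (const_prolongation I \<phi>)"

definition bounded_prolongations ::
    "real set \<Rightarrow> real \<Rightarrow> (real \<Rightarrow> 'e::real_normed_vector) \<Rightarrow> real \<Rightarrow> ereal \<Rightarrow> (real \<Rightarrow> 'e) set" where
  "bounded_prolongations I \<sigma> \<psi> T \<delta> =
     {\<gamma>. prolongation I \<sigma> \<psi> {\<sigma>..\<sigma> + T} \<gamma> \<and>
         (SUP s\<in>{0..T}. ereal (norm (\<gamma> (\<sigma> + s) - \<psi> 0))) \<le> \<delta>}"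

definition rectangle ::
    "real set \<Rightarrow> real \<Rightarrow> (real \<Rightarrow> 'e::real_normed_vector) \<Rightarrow> real \<Rightarrow> ereal \<Rightarrow> (real \<times> (real \<Rightarrow> 'e)) set" where
  "rectangle I \<sigma> \<psi> T \<delta> =
     (\<Union>\<tau>\<in>{0..T}. (\<lambda>\<gamma>. (\<sigma> + \<tau>, shift_map I (\<sigma> + \<tau>) \<gamma>)) ` bounded_prolongations I \<sigma> \<psi> \<tau> \<delta>)"

definition prolongable :: "real set \<Rightarrow> (real \<Rightarrow> 'e::real_normed_vector) topology \<Rightarrow> bool" where
  "prolongable I H \<longleftrightarrow>
     (\<forall>\<psi>\<in>topspace H. \<forall>\<gamma>. prolongation I 0 \<psi> {0..} \<gamma> \<longrightarrow>
        (\<forall>t\<ge>0. shift_map I t \<gamma> \<in> topspace H) \<and>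
        continuous_map (top_of_set {0..}) H (\<lambda>t. shift_map I t \<gamma>))"

definition regulated_by_prolongations ::
    "real set \<Rightarrow> (real \<Rightarrow> 'e::real_normed_vector) topology \<Rightarrow> bool" where
  "regulated_by_prolongations I H \<longleftrightarrow>
     (\<forall>T>0. \<forall>N. nbhd_in H (zero_map I) N \<longrightarrow>
        (\<exists>\<delta>::real. \<delta> > 0 \<and> rectangle I 0 (zero_map I) T (ereal \<delta>) \<subseteq> {0..T} \<times> N))"

definition uniform_nbhd_by_prolongations ::
    "real set \<Rightarrow> (real \<Rightarrow> 'e::real_normed_vector) topology \<Rightarrow> (real \<times> (real \<Rightarrow> 'e)) set \<Rightarrow>
     real \<Rightarrow> (real \<Rightarrow> 'e) \<Rightarrow> bool" where
  "uniform_nbhd_by_prolongations I H W \<sigma>\<^sub>0 \<psi>\<^sub>0 \<longleftrightarrow>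
     (\<exists>T>0. \<exists>\<delta>::real. \<delta> > 0 \<and>
        (\<exists>W\<^sub>0. nbhd_in (subtopology (prod_topology euclideanreal H) W) (\<sigma>\<^sub>0, \<psi>\<^sub>0) W\<^sub>0 \<and>
              (\<Union>(\<sigma>, \<psi>)\<in>W\<^sub>0. rectangle I \<sigma> \<psi> T (ereal \<delta>)) \<subseteq> W))"

section \<open>The right-hand side\<close>

text \<open>
  A partial map \<open>F\<close> is a total function together with its domain \<open>D\<close>; values outside \<open>D\<close>
  are never used. The support of \<open>\<phi>\<^sub>1 - \<phi>\<^sub>2\<close> is the closure relative to \<open>I\<close>, and the supremum norm is
  \<open>\<infinity>\<close> for unbounded maps.
\<close>

definition Lip_ineq ::
    "real set \<Rightarrow> (real \<times> (real \<Rightarrow> 'e::real_normed_vector) \<Rightarrow> 'e) \<Rightarrow> real \<Rightarrow> real \<Rightarrow>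
     (real \<Rightarrow> 'e) \<Rightarrow> (real \<Rightarrow> 'e) \<Rightarrow> bool" where
  "Lip_ineq I F L t \<phi>\<^sub>1 \<phi>\<^sub>2 \<longleftrightarrow>
     ereal (norm (F (t, \<phi>\<^sub>1) - F (t, \<phi>\<^sub>2))) \<le> ereal L * (SUP \<theta>\<in>I. ereal (norm (\<phi>\<^sub>1 \<theta> - \<phi>\<^sub>2 \<theta>)))"

definition locally_Lipschitzian_about_prolongations ::
    "real set \<Rightarrow> (real \<times> (real \<Rightarrow> 'e::real_normed_vector)) set \<Rightarrow>
     (real \<times> (real \<Rightarrow> 'e) \<Rightarrow> 'e) \<Rightarrow> bool" where
  "locally_Lipschitzian_about_prolongations I D F \<longleftrightarrow>
     (\<forall>(\<sigma>\<^sub>0, \<psi>\<^sub>0)\<in>D. \<exists>T>0. \<exists>\<delta>::real. \<delta> > 0 \<and> (\<exists>L>0. \<forall>t \<phi>\<^sub>1 \<phi>\<^sub>2.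
        (t, \<phi>\<^sub>1) \<in> rectangle I \<sigma>\<^sub>0 \<psi>\<^sub>0 T (ereal \<delta>) \<inter> D \<longrightarrow>
        (t, \<phi>\<^sub>2) \<in> rectangle I \<sigma>\<^sub>0 \<psi>\<^sub>0 T (ereal \<delta>) \<inter> D \<longrightarrow>
        compact (top_of_set I closure_of {\<theta> \<in> I. \<phi>\<^sub>1 \<theta> - \<phi>\<^sub>2 \<theta> \<noteq> 0}) \<longrightarrow>
        Lip_ineq I F L t \<phi>\<^sub>1 \<phi>\<^sub>2))"

section \<open>Solutions\<close>

definition ivp_solution ::
    "real set \<Rightarrow> (real \<times> (real \<Rightarrow> 'e::real_normed_vector)) set \<Rightarrow> (real \<times> (real \<Rightarrow> 'e) \<Rightarrow> 'e) \<Rightarrow>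
     real \<Rightarrow> (real \<Rightarrow> 'e) \<Rightarrow> real set \<Rightarrow> (real \<Rightarrow> 'e) \<Rightarrow> bool" where
  "ivp_solution I D F t\<^sub>0 \<phi>\<^sub>0 J x \<longleftrightarrow>
     interval_from t\<^sub>0 J \<and> J \<noteq> {t\<^sub>0} \<and> x \<in> extensional (J + I) \<and>
     shift_map I t\<^sub>0 x = \<phi>\<^sub>0 \<and>
     (\<forall>t\<in>J. (t, shift_map I t x) \<in> D) \<and>
     (\<forall>t\<in>J. (x has_vector_derivative F (t, shift_map I t x)) (at t within J))"

definition C1_on :: "real set \<Rightarrow> (real \<Rightarrow> 'e::real_normed_vector) \<Rightarrow> bool" where
  "C1_on J x \<longleftrightarrow>
     (\<exists>x'. (\<forall>t\<in>J. (x has_vector_derivative x' t) (at t within J)) \<and> continuous_on J x')"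

definition C1_solution ::
    "real set \<Rightarrow> (real \<times> (real \<Rightarrow> 'e::real_normed_vector)) set \<Rightarrow> (real \<times> (real \<Rightarrow> 'e) \<Rightarrow> 'e) \<Rightarrow>
     real \<Rightarrow> (real \<Rightarrow> 'e) \<Rightarrow> real set \<Rightarrow> (real \<Rightarrow> 'e) \<Rightarrow> bool" where
  "C1_solution I D F t\<^sub>0 \<phi>\<^sub>0 J x \<longleftrightarrow> ivp_solution I D F t\<^sub>0 \<phi>\<^sub>0 J x \<and> C1_on J x"

definition sol_le ::
    "real set \<times> (real \<Rightarrow> 'e::real_normed_vector) \<Rightarrow> real set \<times> (real \<Rightarrow> 'e) \<Rightarrow> bool" where
  "sol_le p\<^sub>1 p\<^sub>2 \<longleftrightarrow> fst p\<^sub>1 \<subseteq> fst p\<^sub>2 \<and> (\<forall>t\<in>fst p\<^sub>1. snd p\<^sub>1 t = snd p\<^sub>2 t)"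

definition maximal_C1_solution ::
    "real set \<Rightarrow> (real \<times> (real \<Rightarrow> 'e::real_normed_vector)) set \<Rightarrow> (real \<times> (real \<Rightarrow> 'e) \<Rightarrow> 'e) \<Rightarrow>
     real \<Rightarrow> (real \<Rightarrow> 'e) \<Rightarrow> real set \<Rightarrow> (real \<Rightarrow> 'e) \<Rightarrow> bool" where
  "maximal_C1_solution I D F t\<^sub>0 \<phi>\<^sub>0 J x \<longleftrightarrow>
     C1_solution I D F t\<^sub>0 \<phi>\<^sub>0 J x \<and>
     (\<forall>J' x'. C1_solution I D F t\<^sub>0 \<phi>\<^sub>0 J' x' \<longrightarrow> sol_le (J, x) (J', x') \<longrightarrow> (J', x') = (J, x))"

section \<open>Maximal semiflows and processes\<close>

definition maximal_semiflow ::
    "'a topology \<Rightarrow> (real \<times> 'a) set \<Rightarrow> (real \<times> 'a \<Rightarrow> 'a) \<Rightarrow> bool" where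
  "maximal_semiflow X dom\<Phi> \<Phi> \<longleftrightarrow>
     \<Phi> \<in> dom\<Phi> \<rightarrow> topspace X \<and>
     (\<exists>T :: 'a \<Rightarrow> ereal. (\<forall>x\<in>topspace X. 0 < T x) \<and>
        dom\<Phi> = {(t, x). x \<in> topspace X \<and> 0 \<le> t \<and> ereal t < T x}) \<and>
     (\<forall>x\<in>topspace X. \<Phi> (0, x) = x) \<and>
     (\<forall>t\<^sub>1 t\<^sub>2 x. (t\<^sub>1, x) \<in> dom\<Phi> \<longrightarrow> (t\<^sub>2, \<Phi> (t\<^sub>1, x)) \<in> dom\<Phi> \<longrightarrow>
        (t\<^sub>1 + t\<^sub>2, x) \<in> dom\<Phi> \<and> \<Phi> (t\<^sub>1 + t\<^sub>2, x) = \<Phi> (t\<^sub>2, \<Phi> (t\<^sub>1, x)))"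

definition continuous_maximal_semiflow ::
    "'a topology \<Rightarrow> (real \<times> 'a) set \<Rightarrow> (real \<times> 'a \<Rightarrow> 'a) \<Rightarrow> bool" where
  "continuous_maximal_semiflow X dom\<Phi> \<Phi> \<longleftrightarrow>
     maximal_semiflow X dom\<Phi> \<Phi> \<and>
     openin (prod_topology (top_of_set {0..}) X) dom\<Phi> \<and>
     continuous_map (subtopology (prod_topology (top_of_set {0..}) X) dom\<Phi>) X \<Phi>"

definition continuous_maximal_process ::
    "'a topology \<Rightarrow> (real \<times> 'a) set \<Rightarrow> (real \<times> real \<times> 'a) set \<Rightarrow> (real \<times> real \<times> 'a \<Rightarrow> 'a) \<Rightarrow> bool" where
  "continuous_maximal_process X \<Omega> domP P \<longleftrightarrow>
     continuous_maximal_semiflow (subtopology (prod_topology euclideanreal X) \<Omega>) domP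
       (\<lambda>(\<tau>, (t, x)). (t + \<tau>, P (\<tau>, (t, x))))"

text \<open>
  The functions \<open>T\<^sub>F\<close> and \<open>x\<^sub>F\<close> below are determined on \<open>D\<close> by the first clause, so that the
  existential quantifier only names them.
\<close>

definition maximally_well_posed_C1 ::
    "real set \<Rightarrow> (real \<Rightarrow> 'e::real_normed_vector) topology \<Rightarrow> (real \<times> (real \<Rightarrow> 'e)) set \<Rightarrow>
     (real \<times> (real \<Rightarrow> 'e) \<Rightarrow> 'e) \<Rightarrow> bool" where
  "maximally_well_posed_C1 I H D F \<longleftrightarrow>
     (\<exists>(T\<^sub>F :: real \<times> (real \<Rightarrow> 'e) \<Rightarrow> ereal) (x\<^sub>F :: real \<times> (real \<Rightarrow> 'e) \<Rightarrow> real \<Rightarrow> 'e).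
        (\<forall>(t\<^sub>0, \<phi>\<^sub>0)\<in>D. 0 < T\<^sub>F (t\<^sub>0, \<phi>\<^sub>0) \<and>
           (\<forall>J x. maximal_C1_solution I D F t\<^sub>0 \<phi>\<^sub>0 J x \<longleftrightarrow>
              J = {t. t\<^sub>0 \<le> t \<and> ereal t < ereal t\<^sub>0 + T\<^sub>F (t\<^sub>0, \<phi>\<^sub>0)} \<and> x = x\<^sub>F (t\<^sub>0, \<phi>\<^sub>0))) \<and>
        continuous_maximal_process H D
          {(\<tau>, (t\<^sub>0, \<phi>\<^sub>0)). (t\<^sub>0, \<phi>\<^sub>0) \<in> D \<and> 0 \<le> \<tau> \<and> ereal \<tau> < T\<^sub>F (t\<^sub>0, \<phi>\<^sub>0)}
          (\<lambda>(\<tau>, (t\<^sub>0, \<phi>\<^sub>0)). shift_map I (t\<^sub>0 + \<tau>) (x\<^sub>F (t\<^sub>0, \<phi>\<^sub>0))))"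

end

theory Submission
  imports Defs "HOL-Complex_Analysis.Great_Picard"
begin

text \<open>
  The proof separates the history from the motion of the present value. A prolongation of \<open>\<phi>\<close> is the
  constant prolongation of \<open>\<phi>\<close> plus an increment \<open>z\<close>, a continuous function of elapsed time with \<open>z 0 = 0\<close>.
  Accordingly the state after time \<open>r\<close> is \<open>S0 I r \<phi>\<close> plus the history of \<open>z\<close>. It depends continuously on
  \<open>(r, \<phi>, z)\<close>, where \<open>z\<close> carries the supremum norm: continuity of \<open>S0\<close> takes care of the first summand;
  for the second, prolongability gives continuity in \<open>r\<close>, and regulation by prolongations gives continuity
  in \<open>z\<close>, uniformly in \<open>r\<close> (\<open>evolve_limit\<close>). The initial value problem becomes an integral equation for the
  \<open>E\<close>-valued function \<open>z\<close>, and \<open>H\<close> enters the rest of the proof through this continuity.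
  
  Joint continuity and the uniform neighborhood property bound \<open>F\<close> by a constant \<open>M\<close> on rectangles by
  prolongations of fixed size over a whole neighborhood of initial points (\<open>local_bound\<close>). Existence
  and uniqueness for one initial point follow from the Lipschitz condition by the contraction principle
  (\<open>local_existence\<close>, \<open>uniqueness\<close>). Nearby points have no common Lipschitz constant, but since
  their solutions are \<open>M\<close>-Lipschitz until they leave the rectangle, they can be continued up to a common time
  (\<open>lifetime_lower_bound\<close>).
  
  The delicate point is continuous dependence on the initial point, because the Lipschitz inequality only
  compares prolongations of the same history. In the difference of the two rates, one first exchanges
  the initial point while keeping the increment, and then the increment while keeping the initial point \<open>p\<close>.
  The second difference is covered by the Lipschitz constant at \<open>p\<close>. The first is small by continuity,
  uniformly in the increment, because the \<open>M\<close>-Lipschitz increments form a compact set by Arzela--Ascoli and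
  the tube lemma applies (\<open>uniform_rate_continuity\<close>). This gives continuous dependence for a short time
  (\<open>depends_continuously_local\<close>); induction along the orbit carries it to every time at which the solution
  from \<open>p\<close> exists (\<open>continuous_dependence\<close>). Openness of the domain and continuity of the flow follow at once,
  and the semiflow property is the concatenation of solutions.
\<close>

section \<open>Prolongations as histories with increments\<close>

text \<open>
  The state at time \<open>r\<close> after the start with history \<open>\<phi>\<close>, when the present value has moved by \<open>z s\<close>
  at time \<open>s\<close>. A prolongation of \<open>\<phi>\<close> has the value \<open>\<phi> (min u 0) + z (max u 0)\<close> at local time \<open>u\<close>, which
  splits it into the constant prolongation of \<open>\<phi>\<close> and an increment \<open>z\<close> with \<open>z 0 = 0\<close>. Only the values
  of \<open>z\<close> on \<open>{0..r}\<close> matter, so \<open>z\<close> may be any total function.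
\<close>

definition evolve :: "real set \<Rightarrow> real \<Rightarrow> (real \<Rightarrow> 'e::real_normed_vector) \<Rightarrow> (real \<Rightarrow> 'e) \<Rightarrow> real \<Rightarrow> 'e" where
  "evolve I r \<phi> z = (\<lambda>\<theta>\<in>I. \<phi> (min (r + \<theta>) 0) + z (max (r + \<theta>) 0))"

lemma past_interval_nonpos: "past_interval I \<Longrightarrow> \<theta> \<in> I \<Longrightarrow> \<theta> \<le> 0"
  by (auto simp: past_interval_def)

lemma zero_in_past_interval: "past_interval I \<Longrightarrow> 0 \<in> I"
  by (auto simp: past_interval_def)

lemma past_interval_between:
  assumes "past_interval I" "\<theta> \<in> I" "\<theta> \<le> u" "u \<le> 0" shows "u \<in> I"
  using assms unfolding past_interval_def is_interval_1 by blast

lemma past_interval_min: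
  assumes "past_interval I" "\<theta> \<in> I" "0 \<le> r" shows "min (r + \<theta>) 0 \<in> I"
  using assms past_interval_nonpos[OF assms(1,2)]
  by (intro past_interval_between[OF assms(1,2)]) auto

lemma evolve_extensional: "evolve I r \<phi> z \<in> extensional I"
  by (simp add: evolve_def)

lemma evolve_cong:
  assumes "past_interval I" "0 \<le> r" "\<And>s. 0 \<le> s \<Longrightarrow> s \<le> r \<Longrightarrow> z s = w s"
  shows "evolve I r \<phi> z = evolve I r \<phi> w"
  unfolding evolve_def
  by (intro restrict_ext arg_cong2[where f="(+)"] refl assms(3))
     (use past_interval_nonpos[OF assms(1)] assms(2) in \<open>auto simp: max_def\<close>)

lemma evolve_0:
  assumes "past_interval I" "\<phi> \<in> extensional I" "z 0 = 0" shows "evolve I 0 \<phi> z = \<phi>"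
proof (rule extensionalityI[of _ I])
  fix \<theta> assume "\<theta> \<in> I"
  with past_interval_nonpos[OF assms(1) this] assms(3) show "evolve I 0 \<phi> z \<theta> = \<phi> \<theta>"
    by (simp add: evolve_def min_def max_def)
qed (use assms evolve_extensional in auto)

lemma S0_eq_evolve:
  assumes "past_interval I" "0 \<le> r" shows "S0 I r \<phi> = evolve I r \<phi> (\<lambda>_. 0)"
proof (rule extensionalityI[of _ I])
  fix \<theta> assume th: "\<theta> \<in> I"
  have "r + \<theta> \<in> {0..} + I"
    using assms(2) th by (auto intro: set_plus_intro)
  moreover have "r + \<theta> \<in> I \<longleftrightarrow> r + \<theta> \<le> 0"
    using past_interval_between[OF assms(1) th, of "r + \<theta>"] past_interval_nonpos[OF assms(1), of "r + \<theta>"] assms(2)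
    by auto
  ultimately show "S0 I r \<phi> \<theta> = evolve I r \<phi> (\<lambda>_. 0) \<theta>"
    using th by (auto simp: S0_def shift_map_def const_prolongation_def evolve_def min_def)
qed (auto simp: S0_def shift_map_def evolve_def)

text \<open>
  The initial history enters only through \<open>S0\<close> and the increment only through prolongations of zero.
  Therefore the continuity of the semiflow \<open>S0\<close> controls the former, and prolongability together with
  regulation by prolongations controls the latter.
\<close>

lemma evolve_split:
  assumes "past_interval I" "0 \<le> r"
  shows "evolve I r \<phi> z = add_map I (S0 I r \<phi>) (evolve I r (zero_map I) z)"
  unfolding S0_eq_evolve[OF assms]
  by (auto simp: evolve_def add_map_def zero_map_def fun_eq_iff past_interval_min[OF assms(1) _ assms(2)])

lemma evolve_zero_map_add:
  assumes "past_interval I" "0 \<le> r"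
  shows "evolve I r (zero_map I) (\<lambda>s. z s + w s) =
         add_map I (evolve I r (zero_map I) z) (evolve I r (zero_map I) w)"
  by (auto simp: evolve_def add_map_def zero_map_def fun_eq_iff past_interval_min[OF assms(1) _ assms(2)])

text \<open>
  The cocycle identity that lets solutions be restarted: continuing from the state at time \<open>r\<close> is the
  same as continuing from the initial history with the concatenated increment.
\<close>

lemma evolve_evolve:
  assumes "past_interval I" "0 \<le> r" "0 \<le> s" "w 0 = 0"
  shows "evolve I s (evolve I r \<phi> z) w = evolve I (r + s) \<phi> (\<lambda>u. if u \<le> r then z u else z r + w (u - r))"
proof (rule extensionalityI[of _ I])
  fix \<theta> assume th: "\<theta> \<in> I"
  show "evolve I s (evolve I r \<phi> z) w \<theta> = evolve I (r + s) \<phi> (\<lambda>u. if u \<le> r then z u else z r + w (u - r)) \<theta>"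
    using th past_interval_min[OF assms(1) th assms(3)] assms(2,4)
    by (auto simp: evolve_def min_def max_def algebra_simps)
qed (auto simp: evolve_extensional)

lemma evolve_shifted_increment:
  assumes "past_interval I" "0 \<le> r" "0 \<le> s"
  shows "evolve I s (evolve I r \<phi> z) (\<lambda>u. z (r + u) - z r) = evolve I (r + s) \<phi> z"
  by (subst evolve_evolve[OF assms]) (auto intro!: evolve_cong simp: assms add_nonneg_nonneg)

lemma evolve_in_rectangle:
  fixes z :: "real \<Rightarrow> 'e::real_normed_vector"
  assumes I: "past_interval I" and tau: "0 \<le> \<tau>" "\<tau> \<le> T" and psi: "\<psi> \<in> extensional I"
    and z: "continuous_on {0..\<tau>} z" "z 0 = 0" "\<And>s. 0 \<le> s \<Longrightarrow> s \<le> \<tau> \<Longrightarrow> norm (z s) \<le> \<delta>"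
  shows "(\<sigma> + \<tau>, evolve I \<tau> \<psi> z) \<in> rectangle I \<sigma> \<psi> T (ereal \<delta>)"
proof -
  define J where "J = {\<sigma>..\<sigma> + \<tau>}"
  define \<gamma> where "\<gamma> = (\<lambda>t\<in>J + I. \<psi> (min (t - \<sigma>) 0) + z (max (t - \<sigma>) 0))"
  have JI: "t + \<theta> \<in> J + I" if "t \<in> J" "\<theta> \<in> I" for t \<theta>
    using that by (auto intro: set_plus_intro)
  have J_sub: "t \<in> J + I" if "t \<in> J" for t
    using JI[OF that zero_in_past_interval[OF I]] by simp
  have shift: "shift_map I (\<sigma> + s) \<gamma> = evolve I s \<psi> z" if "0 \<le> s" "s \<le> \<tau>" for s
    using JI[of "\<sigma> + s"] that by (auto simp: shift_map_def \<gamma>_def evolve_def J_def fun_eq_iff)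
  have g: "\<gamma> t = \<psi> 0 + z (t - \<sigma>)" if "t \<in> J" for t
    using that J_sub[OF that] by (auto simp: \<gamma>_def J_def)
  have cont: "continuous_on J \<gamma>"
  proof -
    have "continuous_on J (\<lambda>t. \<psi> 0 + z (t - \<sigma>))"
      by (intro continuous_intros continuous_on_compose2[OF z(1)]) (auto simp: J_def)
    then show ?thesis by (rule continuous_on_eq) (simp add: g)
  qed
  have "prolongation I \<sigma> \<psi> J \<gamma>"
    unfolding prolongation_def
    using shift[of 0] evolve_0[OF I psi, of z] z(2) tau cont
    by (auto simp: interval_from_def J_def \<gamma>_def)
  moreover have "(SUP s\<in>{0..\<tau>}. ereal (norm (\<gamma> (\<sigma> + s) - \<psi> 0))) \<le> ereal \<delta>"
    using z(3) by (intro SUP_least) (auto simp: g J_def)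
  ultimately have "\<gamma> \<in> bounded_prolongations I \<sigma> \<psi> \<tau> (ereal \<delta>)"
    by (simp add: bounded_prolongations_def J_def)
  then show ?thesis
    unfolding rectangle_def using shift[of \<tau>] tau
    by (intro UN_I[of \<tau>]) (auto intro!: image_eqI[of _ _ \<gamma>])
qed

text \<open>
  The Lipschitz inequality is only available for differences of compact support. If \<open>I\<close> is a bounded
  interval without its left end point, then a compactly supported difference is guaranteed only while
  the elapsed time stays below the length of \<open>I\<close>; this is where the bound \<open>h\<close> comes from.
\<close>

lemma compact_recent_past:
  assumes I: "past_interval I"
  obtains h where "h > 0" "\<And>r. r \<le> h \<Longrightarrow> compact (I \<inter> {- r..0})"
proof (cases "I = {0}")
  case True
  show ?thesis by (rule that[of 1]) (auto simp: True)
next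
  case False
  then obtain \<theta> where th: "\<theta> \<in> I" "\<theta> \<noteq> 0"
    using zero_in_past_interval[OF I] by auto
  show ?thesis
  proof (rule that[of "- \<theta>"])
    show "- \<theta> > 0" using th past_interval_nonpos[OF I] by force
    fix r assume "r \<le> - \<theta>"
    then have "I \<inter> {- r..0} = {- r..0}"
      using past_interval_between[OF I th(1)] by auto
    then show "compact (I \<inter> {- r..0})" by simp
  qed
qed

lemma compact_support_diff_evolve:
  assumes I: "past_interval I" and r: "0 \<le> r" "compact (I \<inter> {- r..0})" and "z 0 = w 0"
  shows "compact (top_of_set I closure_of {\<theta> \<in> I. evolve I r \<phi> z \<theta> - evolve I r \<phi> w \<theta> \<noteq> 0})"
    (is "compact (_ closure_of ?S)")
proof -
  have "?S \<subseteq> {- r..}"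
    using assms(4) by (auto simp: evolve_def max_def split: if_splits)
  then have "closure ?S \<subseteq> {- r..}" by (intro closure_minimal) auto
  then have "top_of_set I closure_of ?S = (I \<inter> {- r..0}) \<inter> closure ?S"
    using past_interval_nonpos[OF I] by (auto simp: closure_of_subtopology Int_absorb1)
  then show ?thesis
    using r(2) by (simp add: compact_Int_closed)
qed

text \<open>
  Two prolongations of one history differ only by their increments, so the supremum norm over \<open>I\<close>
  reduces to a supremum over the elapsed time interval.
\<close>

lemma Lip_ineq_evolveD:
  assumes I: "past_interval I" and "Lip_ineq I F L t (evolve I r \<phi> z) (evolve I r \<phi> w)"
    and "0 \<le> r" "0 \<le> L" and B: "\<And>s. 0 \<le> s \<Longrightarrow> s \<le> r \<Longrightarrow> norm (z s - w s) \<le> B"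
  shows "norm (F (t, evolve I r \<phi> z) - F (t, evolve I r \<phi> w)) \<le> L * B"
proof -
  have "(SUP \<theta>\<in>I. ereal (norm (evolve I r \<phi> z \<theta> - evolve I r \<phi> w \<theta>))) \<le> ereal B"
  proof (intro SUP_least)
    fix \<theta> assume "\<theta> \<in> I"
    then have "0 \<le> max (r + \<theta>) 0" "max (r + \<theta>) 0 \<le> r"
      using past_interval_nonpos[OF I, of \<theta>] assms(3) by auto
    from B[OF this] \<open>\<theta> \<in> I\<close>
    show "ereal (norm (evolve I r \<phi> z \<theta> - evolve I r \<phi> w \<theta>)) \<le> ereal B"
      by (simp add: evolve_def)
  qed
  then have SUP_le: "ereal L * (SUP \<theta>\<in>I. ereal (norm (evolve I r \<phi> z \<theta> - evolve I r \<phi> w \<theta>))) \<le> ereal L * ereal B"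
    by (rule ereal_mult_left_mono) (use assms(4) in simp)
  have "ereal (norm (F (t, evolve I r \<phi> z) - F (t, evolve I r \<phi> w))) \<le> ereal L * ereal B"
    by (rule order_trans[OF assms(2)[unfolded Lip_ineq_def] SUP_le])
  then show ?thesis by simp
qed

section \<open>Continuity of the state\<close>

lemma limitin_nhdsin_self: "x \<in> topspace X \<Longrightarrow> limitin X (\<lambda>y. y) x (nhdsin X x)"
  by (auto simp: limitin_def eventually_nhdsin)

text \<open>
  Since \<open>H\<close> need not be first countable, sequences are replaced by limits along arbitrary filters, and
  continuity is checked along the neighborhood filter of each point.
\<close>

lemma continuous_map_limits:
  assumes "\<And>x. x \<in> topspace X \<Longrightarrow> limitin Y f (f x) (nhdsin X x)"
  shows "continuous_map X Y f"
  unfolding continuous_map_eq_topcontinuous_at topcontinuous_at_def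
proof (intro ballI conjI allI impI)
  fix x assume x: "x \<in> topspace X"
  show "x \<in> topspace X" by fact
  show "f \<in> topspace X \<rightarrow> topspace Y" using assms[THEN limitin_topspace] by auto
  fix V assume "openin Y V \<and> f x \<in> V"
  then have "\<forall>\<^sub>F y in nhdsin X x. f y \<in> V" using assms[OF x] limitinD by metis
  then show "\<exists>U. openin X U \<and> x \<in> U \<and> (\<forall>y\<in>U. f y \<in> V)" using x by (auto simp: eventually_nhdsin)
qed

lemma limitin_Pair:
  "limitin (prod_topology X Y) (\<lambda>i. (f i, g i)) (x, y) \<F> \<longleftrightarrow> limitin X f x \<F> \<and> limitin Y g y \<F>"
  by (simp add: limitin_pairwise o_def)

lemma limitin_nonneg_reals:
  fixes r :: "'i \<Rightarrow> real"
  shows "limitin (top_of_set {0..}) r r0 \<F> \<longleftrightarrow> 0 \<le> r0 \<and> (\<forall>\<^sub>F i in \<F>. 0 \<le> r i) \<and> (r \<longlongrightarrow> r0) \<F>"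
  by (simp add: limitin_subtopology)

locale retarded_ivp =
  fixes I :: "real set"
    and H :: "(real \<Rightarrow> 'e::euclidean_space) topology"
    and D :: "(real \<times> (real \<Rightarrow> 'e)) set"
    and F :: "real \<times> (real \<Rightarrow> 'e) \<Rightarrow> 'e"
  assumes past: "past_interval I"
    and history: "history_space I H"
    and D_subset: "D \<subseteq> UNIV \<times> topspace H"
    and prolong: "prolongable I H"
    and regulated: "regulated_by_prolongations I H"
    and F_continuous: "continuous_map (subtopology (prod_topology euclideanreal H) D) euclidean F"
    and D_uniform_nbhd: "\<forall>(t, \<phi>)\<in>D. uniform_nbhd_by_prolongations I H D t \<phi>"
    and F_Lipschitz: "locally_Lipschitzian_about_prolongations I D F"
    and S0_continuous: "continuous_map (prod_topology (top_of_set {0..}) H) H (\<lambda>(t, \<phi>). S0 I t \<phi>)"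
begin

abbreviation X :: "(real \<times> (real \<Rightarrow> 'e)) topology" where
  "X \<equiv> subtopology (prod_topology euclideanreal H) D"

lemma topspace_X: "topspace X = D"
  using D_subset by auto

lemma D_extensional: "(t, \<phi>) \<in> D \<Longrightarrow> \<phi> \<in> extensional I"
  using D_subset history by (auto simp: history_space_def)

lemma limitin_X_iff:
  "limitin X q p \<F> \<longleftrightarrow>
     p \<in> D \<and> (\<forall>\<^sub>F i in \<F>. q i \<in> D) \<and> ((\<lambda>i. fst (q i)) \<longlongrightarrow> fst p) \<F> \<and> limitin H (\<lambda>i. snd (q i)) (snd p) \<F>"
  by (auto simp: limitin_subtopology limitin_pairwise o_def)

lemma F_limit: "limitin X q p \<F> \<Longrightarrow> ((\<lambda>i. F (q i)) \<longlongrightarrow> F p) \<F>"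
  using continuous_map_limit[OF F_continuous] by (simp add: o_def)

lemma S0_limit:
  assumes "limitin H \<psi> \<psi>0 \<F>" "(r \<longlongrightarrow> r0) \<F>" "\<forall>\<^sub>F i in \<F>. 0 \<le> r i" "0 \<le> r0"
  shows "limitin H (\<lambda>i. S0 I (r i) (\<psi> i)) (S0 I r0 \<psi>0) \<F>"
proof -
  have "limitin (prod_topology (top_of_set {0..}) H) (\<lambda>i. (r i, \<psi> i)) (r0, \<psi>0) \<F>"
    using assms by (simp add: limitin_Pair limitin_nonneg_reals)
  from continuous_map_limit[OF S0_continuous this] show ?thesis
    by (simp add: o_def)
qed

lemma add_limit:
  assumes "limitin H \<phi> \<phi>0 \<F>" "limitin H \<psi> \<psi>0 \<F>"
  shows "limitin H (\<lambda>i. add_map I (\<phi> i) (\<psi> i)) (add_map I \<phi>0 \<psi>0) \<F>"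
proof -
  have "continuous_map (prod_topology H H) H (\<lambda>(\<phi>, \<psi>). add_map I \<phi> \<psi>)"
    using history by (simp add: history_space_def)
  moreover have "limitin (prod_topology H H) (\<lambda>i. (\<phi> i, \<psi> i)) (\<phi>0, \<psi>0) \<F>"
    using assms by (simp add: limitin_Pair)
  ultimately show ?thesis
    using continuous_map_limit by (fastforce simp: o_def)
qed

text \<open>
  Prolongability, applied to the prolongation \<open>z\<close> of the zero history.
\<close>

lemma increment_continuous:
  fixes z :: "real \<Rightarrow> 'e"
  assumes z: "continuous_on {0..} z" "z 0 = 0"
  shows "continuous_map (top_of_set {0..}) H (\<lambda>r. evolve I r (zero_map I) z)"
proof -
  define \<gamma> where "\<gamma> = (\<lambda>t\<in>{0..} + I. z (max t 0))"
  have shift: "shift_map I r \<gamma> = evolve I r (zero_map I) z" if "0 \<le> r" for r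
  proof (rule extensionalityI[of _ I])
    fix \<theta> assume th: "\<theta> \<in> I"
    then have "r + \<theta> \<in> {0..} + I"
      using that by (intro set_plus_intro) auto
    then show "shift_map I r \<gamma> \<theta> = evolve I r (zero_map I) z \<theta>"
      using th past_interval_min[OF past th that] by (simp add: shift_map_def \<gamma>_def evolve_def zero_map_def)
  qed (auto simp: shift_map_def evolve_def)
  have pro: "prolongation I 0 (zero_map I) {0..} \<gamma>"
    unfolding prolongation_def
  proof (intro conjI)
    show "interval_from 0 {0..}"
      by (auto simp: interval_from_def is_interval_1)
    show "\<gamma> \<in> extensional ({0..} + I)"
      by (simp add: \<gamma>_def)
    show "shift_map I 0 \<gamma> = zero_map I"
      using shift[of 0] evolve_0[OF past, of "zero_map I" z] z(2) by (simp add: zero_map_def)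
    show "continuous_on {0..} \<gamma>"
    proof (rule continuous_on_eq[OF z(1)])
      fix t :: real assume "t \<in> {0..}"
      then show "z t = \<gamma> t"
        using set_plus_intro[of t "{0..}" 0 I] zero_in_past_interval[OF past] by (simp add: \<gamma>_def)
    qed
  qed
  have "zero_map I \<in> topspace H"
    using history by (simp add: history_space_def)
  then have "continuous_map (top_of_set {0..}) H (\<lambda>t. shift_map I t \<gamma>)"
    using prolong pro unfolding prolongable_def by blast
  then show ?thesis
    by (rule continuous_map_eq) (simp add: shift)
qed

text \<open>
  Regulation by prolongations, rephrased: uniformly small increments give histories near zero,
  uniformly for bounded elapsed times.
\<close>

lemma small_increment_limit:
  fixes z :: "'i \<Rightarrow> real \<Rightarrow>\<^sub>C 'e"
  assumes r: "\<forall>\<^sub>F i in \<F>. 0 \<le> r i" "\<forall>\<^sub>F i in \<F>. r i \<le> T"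
    and z: "(z \<longlongrightarrow> 0) \<F>" "\<forall>\<^sub>F i in \<F>. z i 0 = 0"
  shows "limitin H (\<lambda>i. evolve I (r i) (zero_map I) (z i)) (zero_map I) \<F>"
  unfolding limitin_def
proof (intro conjI allI impI)
  show zero: "zero_map I \<in> topspace H"
    using history by (simp add: history_space_def)
  fix U assume U: "openin H U \<and> zero_map I \<in> U"
  then have "nbhd_in H (zero_map I) U"
    using openin_subset by (auto simp: nbhd_in_def)
  then obtain \<delta> where \<delta>: "\<delta> > 0" "rectangle I 0 (zero_map I) (max T 1) (ereal \<delta>) \<subseteq> {0..max T 1} \<times> U"
    using regulated unfolding regulated_by_prolongations_def by (metis less_max_iff_disj zero_less_one)
  have "\<forall>\<^sub>F i in \<F>. dist (z i) 0 < \<delta>"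
    using z(1) \<delta>(1) by (rule tendstoD)
  then show "\<forall>\<^sub>F i in \<F>. evolve I (r i) (zero_map I) (z i) \<in> U"
    using r z(2)
  proof eventually_elim
    case (elim i)
    have "norm (z i s) \<le> \<delta>" for s
      using dist_bounded[of "z i" s 0] elim(1) by simp
    then have "(0 + r i, evolve I (r i) (zero_map I) (z i)) \<in> rectangle I 0 (zero_map I) (max T 1) (ereal \<delta>)"
      using elim zero history
      by (intro evolve_in_rectangle[OF past]) (auto simp: history_space_def)
    with \<delta>(2) show ?case by auto
  qed
qed

text \<open>
  Joint continuity of the state in elapsed time, history and increment, the last in the supremum norm.
  The increment is written as \<open>z0 + (z i - z0)\<close>: the first part is fixed and depends continuously on
  time, the second is uniformly small.
\<close>

lemma evolve_limit:
  fixes z :: "'i \<Rightarrow> real \<Rightarrow>\<^sub>C 'e"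
  assumes \<psi>: "limitin H \<psi> \<psi>0 \<F>"
    and r: "(r \<longlongrightarrow> r0) \<F>" "\<forall>\<^sub>F i in \<F>. 0 \<le> r i" "0 \<le> r0"
    and z: "(z \<longlongrightarrow> z0) \<F>" "\<forall>\<^sub>F i in \<F>. z i 0 = 0" "z0 0 = 0"
  shows "limitin H (\<lambda>i. evolve I (r i) (\<psi> i) (z i)) (evolve I r0 \<psi>0 z0) \<F>"
proof -
  have "limitin (top_of_set {0..}) r r0 \<F>"
    using r by (simp add: limitin_nonneg_reals)
  from continuous_map_limit[OF increment_continuous[of z0, OF _ z(3)] this]
  have fixed: "limitin H (\<lambda>i. evolve I (r i) (zero_map I) z0) (evolve I r0 (zero_map I) z0) \<F>"
    by (simp add: o_def)
  have "\<forall>\<^sub>F i in \<F>. r i < r0 + 1"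
    using r(1) by (rule order_tendstoD) simp
  then have "\<forall>\<^sub>F i in \<F>. r i \<le> r0 + 1"
    by (rule eventually_mono) simp
  moreover have "((\<lambda>i. z i - z0) \<longlongrightarrow> 0) \<F>"
    using tendsto_diff[OF z(1) tendsto_const[of z0]] by simp
  moreover have "\<forall>\<^sub>F i in \<F>. (z i - z0) 0 = 0"
    using z(2) by (rule eventually_mono) (simp add: z(3))
  ultimately have small: "limitin H (\<lambda>i. evolve I (r i) (zero_map I) (z i - z0)) (zero_map I) \<F>"
    by (intro small_increment_limit[OF r(2)])
  have lim: "limitin H (\<lambda>i. add_map I (S0 I (r i) (\<psi> i))
      (add_map I (evolve I (r i) (zero_map I) z0) (evolve I (r i) (zero_map I) (z i - z0))))
     (add_map I (S0 I r0 \<psi>0) (add_map I (evolve I r0 (zero_map I) z0) (zero_map I))) \<F>" (is "limitin H ?f ?l \<F>")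
    by (intro add_limit S0_limit[OF \<psi> r] fixed small)
  have l: "?l = evolve I r0 \<psi>0 z0"
  proof -
    have "add_map I (evolve I r0 (zero_map I) z0) (zero_map I) = evolve I r0 (zero_map I) z0"
      by (auto simp: add_map_def zero_map_def evolve_def)
    then show ?thesis using evolve_split[OF past r(3), of \<psi>0 z0] by simp
  qed
  have "\<forall>\<^sub>F i in \<F>. ?f i = evolve I (r i) (\<psi> i) (z i)"
    using r(2)
  proof eventually_elim
    case (elim i)
    show ?case
      using evolve_zero_map_add[OF past elim, of z0 "z i - z0"] evolve_split[OF past elim, of "\<psi> i" "z i"] by simp
  qed
  from limitin_transform_eventually[OF this lim] show ?thesis
    by (simp only: l)
qed

end

section \<open>Local bounds and Lipschitz estimates\<close>

text \<open>
  Increments are only relevant on compact intervals; freezing them outside turns them into points of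
  the Banach space of bounded continuous functions, where the contraction principle and compactness
  arguments take place.
\<close>

definition truncate :: "real \<Rightarrow> (real \<Rightarrow> 'e::real_normed_vector) \<Rightarrow> real \<Rightarrow>\<^sub>C 'e" where
  "truncate b z = Bcontfun (\<lambda>s. z (max 0 (min s b)))"

lemma truncate_apply:
  fixes z :: "real \<Rightarrow> 'e::real_normed_vector"
  assumes "0 \<le> b" "continuous_on {0..b} z"
  shows "apply_bcontfun (truncate b z) s = z (max 0 (min s b))"
proof -
  have "continuous_on UNIV (\<lambda>s. z (max 0 (min s b)))"
    using assms(1) by (intro continuous_on_compose2[OF assms(2)] continuous_intros) auto
  moreover have "bounded (range (\<lambda>s. z (max 0 (min s b))))"
    by (rule bounded_subset[OF compact_imp_bounded[OF compact_continuous_image[OF assms(2)]]])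
       (use assms(1) in auto)
  ultimately show ?thesis
    by (simp add: truncate_def bcontfun_def Bcontfun_inverse)
qed

lemma norm_truncate_le:
  fixes z :: "real \<Rightarrow> 'e::real_normed_vector"
  assumes "0 \<le> b" "continuous_on {0..b} z" "\<And>s. s \<in> {0..b} \<Longrightarrow> norm (z s) \<le> c"
  shows "norm (truncate b z) \<le> c"
  by (rule norm_bound) (use assms in \<open>simp add: truncate_apply\<close>)

lemma dist_truncate_le:
  fixes z w :: "real \<Rightarrow> 'e::real_normed_vector"
  assumes "0 \<le> b" "continuous_on {0..b} z" "continuous_on {0..b} w"
    and "\<And>s. s \<in> {0..b} \<Longrightarrow> norm (z s - w s) \<le> c"
  shows "dist (truncate b z) (truncate b w) \<le> c"
  by (rule dist_bound) (use assms in \<open>simp add: truncate_apply dist_norm\<close>)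

lemma evolve_truncate:
  fixes z :: "real \<Rightarrow> 'e::real_normed_vector"
  assumes "past_interval I" "0 \<le> r" "r \<le> b" "continuous_on {0..b} z"
  shows "evolve I r \<phi> (truncate b z) = evolve I r \<phi> z"
  using assms by (intro evolve_cong) (auto simp: truncate_apply)

lemma limitin_compose_filterlim:
  assumes "limitin X f l \<F>" "filterlim g \<F> \<G>"
  shows "limitin X (\<lambda>i. f (g i)) l \<G>"
  using assms unfolding limitin_def by (auto dest: eventually_compose_filterlim)

context retarded_ivp
begin

definition state :: "real \<times> (real \<Rightarrow> 'e) \<Rightarrow> (real \<Rightarrow> 'e) \<Rightarrow> real \<Rightarrow> real \<times> (real \<Rightarrow> 'e)" where
  "state p z r = (fst p + r, evolve I r (snd p) z)"

lemma state_truncate: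
  assumes "0 \<le> r" "r \<le> b" "continuous_on {0..b} z"
  shows "state p (truncate b z) r = state p z r"
  by (simp add: state_def evolve_truncate[OF past assms])

lemma state_cong:
  assumes "0 \<le> r" "\<And>s. 0 \<le> s \<Longrightarrow> s \<le> r \<Longrightarrow> z s = w s"
  shows "state p z r = state p w r"
  using evolve_cong[OF past assms] by (simp add: state_def)

lemma state_0: "p \<in> D \<Longrightarrow> z 0 = 0 \<Longrightarrow> state p z 0 = p"
  using evolve_0[OF past D_extensional, of "fst p" "snd p" z] by (simp add: state_def)

lemma state_state:
  assumes "0 \<le> r" "0 \<le> s" "w 0 = 0"
  shows "state (state p z r) w s = state p (\<lambda>u. if u \<le> r then z u else z r + w (u - r)) (r + s)"
  using evolve_evolve[OF past assms(1,2), of w] assms(3) by (simp add: state_def)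

lemma state_shifted_increment:
  assumes "0 \<le> r" "0 \<le> s"
  shows "state (state p z r) (\<lambda>u. z (r + u) - z r) s = state p z (r + s)"
  using evolve_shifted_increment[OF past assms] by (simp add: state_def)

lemma state_limit:
  fixes z :: "'i \<Rightarrow> real \<Rightarrow>\<^sub>C 'e"
  assumes q: "limitin X q p \<F>"
    and r: "(r \<longlongrightarrow> r0) \<F>" "\<forall>\<^sub>F i in \<F>. 0 \<le> r i" "0 \<le> r0"
    and z: "(z \<longlongrightarrow> z0) \<F>" "\<forall>\<^sub>F i in \<F>. z i 0 = 0" "z0 0 = 0"
    and D: "\<forall>\<^sub>F i in \<F>. state (q i) (z i) (r i) \<in> D" "state p z0 r0 \<in> D"
  shows "limitin X (\<lambda>i. state (q i) (z i) (r i)) (state p z0 r0) \<F>"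
  unfolding limitin_X_iff
  using q D evolve_limit[OF _ r z, of "\<lambda>i. snd (q i)" "snd p"]
  by (auto simp: limitin_X_iff state_def intro!: tendsto_add r(1))

lemma D_rectangle:
  assumes p: "p \<in> D"
  obtains U T \<delta> where "openin X U" "p \<in> U" "T > 0" "\<delta> > 0"
    and "\<And>q r z. q \<in> U \<Longrightarrow> 0 \<le> r \<Longrightarrow> r \<le> T \<Longrightarrow> continuous_on {0..r} z \<Longrightarrow> z 0 = 0 \<Longrightarrow>
           (\<And>s. s \<in> {0..r} \<Longrightarrow> norm (z s) \<le> \<delta>) \<Longrightarrow> state q z r \<in> D"
proof -
  obtain T \<delta> W where T: "T > 0" "(\<delta>::real) > 0" and W: "nbhd_in X p W"
    and sub: "(\<Union>(\<sigma>, \<psi>)\<in>W. rectangle I \<sigma> \<psi> T (ereal \<delta>)) \<subseteq> D"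
    using D_uniform_nbhd p by (cases p) (fastforce simp: uniform_nbhd_by_prolongations_def)
  obtain U where U: "openin X U" "p \<in> U" "U \<subseteq> W"
    using W by (auto simp: nbhd_in_def)
  show ?thesis
  proof (rule that[OF U(1,2) T])
    fix q r and z :: "real \<Rightarrow> 'e"
    assume q: "q \<in> U" and r: "0 \<le> r" "r \<le> T" and z: "continuous_on {0..r} z" "z 0 = 0"
      "\<And>s. s \<in> {0..r} \<Longrightarrow> norm (z s) \<le> \<delta>"
    have "q \<in> D" using q U openin_subset topspace_X by blast
    then have "state q z r \<in> rectangle I (fst q) (snd q) T (ereal \<delta>)"
      unfolding state_def using D_extensional[of "fst q" "snd q"] r z
      by (intro evolve_in_rectangle[OF past]) auto
    then show "state q z r \<in> D"
      using sub q U(3) by (cases q) auto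
  qed
qed

text \<open>
  The state map sends \<open>(p, 0, 0)\<close> to \<open>p\<close>, and \<open>F\<close> is continuous at \<open>p\<close>; joint continuity of the state
  map in initial point, elapsed time and increment thus bounds \<open>F\<close> on small rectangles by
  prolongations, uniformly over a neighborhood of initial points.
\<close>

lemma local_bound:
  assumes p: "p \<in> D"
  obtains U a \<delta> M where "openin X U" "p \<in> U" "a > 0" "\<delta> > 0" "M > 0"
    and "\<And>q r z. q \<in> U \<Longrightarrow> 0 \<le> r \<Longrightarrow> r \<le> a \<Longrightarrow> continuous_on {0..r} z \<Longrightarrow> z 0 = 0 \<Longrightarrow>
           (\<And>s. s \<in> {0..r} \<Longrightarrow> norm (z s) \<le> \<delta>) \<Longrightarrow> state q z r \<in> D \<and> norm (F (state q z r)) \<le> M"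
proof -
  obtain U0 T \<delta>0 where U0: "openin X U0" "p \<in> U0" and T: "T > 0" "\<delta>0 > 0"
    and D: "\<And>q r z. q \<in> U0 \<Longrightarrow> 0 \<le> r \<Longrightarrow> r \<le> T \<Longrightarrow> continuous_on {0..r} z \<Longrightarrow> z 0 = 0 \<Longrightarrow>
           (\<And>s. s \<in> {0..r} \<Longrightarrow> norm (z s) \<le> \<delta>0) \<Longrightarrow> state q z r \<in> D"
    using D_rectangle[OF p] by blast
  \<comment> \<open>The product filter describes an initial point tending to \<open>p\<close>, an elapsed time tending to \<open>0\<close>
     through nonnegative values, and an admissible increment tending to \<open>0\<close>.\<close>
  define R :: "real filter" where "R = inf (nhds 0) (principal {0..})"
  define Z :: "(real \<Rightarrow>\<^sub>C 'e) filter" where "Z = inf (nhds 0) (principal {z. apply_bcontfun z 0 = 0})"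
  define \<F> where "\<F> = nhdsin X p \<times>\<^sub>F (R \<times>\<^sub>F Z)"
  have q: "filterlim fst (nhdsin X p) \<F>"
    and r: "filterlim (\<lambda>i. fst (snd i)) R \<F>"
    and z: "filterlim (\<lambda>i. snd (snd i)) Z \<F>"
    unfolding \<F>_def
    by (auto intro!: filterlim_fst filterlim_compose[OF filterlim_fst filterlim_snd]
        filterlim_compose[OF filterlim_snd filterlim_snd])
  have r0: "((\<lambda>i. fst (snd i)) \<longlongrightarrow> 0) \<F>" "\<forall>\<^sub>F i in \<F>. 0 \<le> fst (snd i)"
    using r unfolding R_def filterlim_inf filterlim_principal by auto
  have z0: "((\<lambda>i. snd (snd i)) \<longlongrightarrow> 0) \<F>" "\<forall>\<^sub>F i in \<F>. apply_bcontfun (snd (snd i)) 0 = 0"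
    using z unfolding Z_def filterlim_inf filterlim_principal by auto
  have q0: "limitin X fst p \<F>"
    by (rule limitin_compose_filterlim[OF limitin_nhdsin_self q]) (simp only: topspace_X p)
  have st0: "state p (0 :: real \<Rightarrow>\<^sub>C 'e) 0 = p"
    by (simp add: state_0[OF p])
  have inD: "\<forall>\<^sub>F i in \<F>. state (fst i) (apply_bcontfun (snd (snd i))) (fst (snd i)) \<in> D"
  proof -
    have "\<forall>\<^sub>F i in \<F>. fst i \<in> U0"
      using limitinD[OF q0 U0] .
    moreover have "\<forall>\<^sub>F i in \<F>. fst (snd i) < T"
      using order_tendstoD(2)[OF r0(1) T(1)] .
    moreover have "\<forall>\<^sub>F i in \<F>. dist (snd (snd i)) 0 < \<delta>0"
      using tendstoD[OF z0(1) T(2)] .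
    ultimately show ?thesis
      using r0(2) z0(2)
    proof eventually_elim
      case (elim i)
      have "norm (apply_bcontfun (snd (snd i)) s) \<le> \<delta>0" for s
        using dist_bounded[of "snd (snd i)" s 0] elim(3) by simp
      then show ?case
        using elim by (intro D) auto
    qed
  qed
  have "limitin X (\<lambda>i. state (fst i) (apply_bcontfun (snd (snd i))) (fst (snd i))) (state p (0 :: real \<Rightarrow>\<^sub>C 'e) 0) \<F>"
    by (intro state_limit q0 r0 z0 inD) (use st0 p in auto)
  then have "((\<lambda>i. norm (F (state (fst i) (apply_bcontfun (snd (snd i))) (fst (snd i))))) \<longlongrightarrow> norm (F p)) \<F>"
    unfolding st0 by (intro tendsto_norm F_limit)
  then have "\<forall>\<^sub>F i in \<F>. norm (F (state (fst i) (apply_bcontfun (snd (snd i))) (fst (snd i)))) < norm (F p) + 1"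
    by (rule order_tendstoD) simp
  with inD have "\<forall>\<^sub>F i in \<F>. state (fst i) (apply_bcontfun (snd (snd i))) (fst (snd i)) \<in> D \<and>
      norm (F (state (fst i) (apply_bcontfun (snd (snd i))) (fst (snd i)))) < norm (F p) + 1"
    by (rule eventually_conj)
  then obtain Q R' Z' where ev: "eventually Q (nhdsin X p)" "eventually R' R" "eventually Z' Z"
    and QRZ: "\<And>q r z. Q q \<Longrightarrow> R' r \<Longrightarrow> Z' z \<Longrightarrow> state q (apply_bcontfun z) r \<in> D \<and> norm (F (state q (apply_bcontfun z) r)) < norm (F p) + 1"
    unfolding \<F>_def eventually_prod_filter by fastforce
  obtain U where U: "openin X U" "p \<in> U" "\<And>q. q \<in> U \<Longrightarrow> Q q"
    using ev(1) p topspace_X by (auto simp: eventually_nhdsin)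
  obtain a where a: "a > 0" "\<And>r. 0 \<le> r \<Longrightarrow> r < a \<Longrightarrow> R' r"
    using ev(2) unfolding R_def eventually_inf_principal eventually_nhds_metric by (auto simp: dist_norm)
  obtain \<delta> where \<delta>: "\<delta> > 0" "\<And>z :: real \<Rightarrow>\<^sub>C 'e. apply_bcontfun z 0 = 0 \<Longrightarrow> norm z < \<delta> \<Longrightarrow> Z' z"
    using ev(3) unfolding Z_def eventually_inf_principal eventually_nhds_metric by auto
  show ?thesis
  proof (rule that[OF U(1,2), of "a / 2" "\<delta> / 2" "norm (F p) + 1"])
    fix q r and z :: "real \<Rightarrow> 'e"
    assume *: "q \<in> U" "0 \<le> r" "r \<le> a / 2" "continuous_on {0..r} z" "z 0 = 0"
      "\<And>s. s \<in> {0..r} \<Longrightarrow> norm (z s) \<le> \<delta> / 2"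
    have "norm (truncate r z) \<le> \<delta> / 2"
      by (rule norm_truncate_le[OF *(2,4,6)])
    then have "Z' (truncate r z)"
      using * \<delta>(1) by (intro \<delta>(2)) (auto simp: truncate_apply)
    moreover have "R' r"
      using * a(1) by (intro a(2)) auto
    ultimately show "state q z r \<in> D \<and> norm (F (state q z r)) \<le> norm (F p) + 1"
      using QRZ[OF U(3)[OF *(1)], of r "truncate r z"] state_truncate[OF *(2) order_refl *(4)]
      by simp
  qed (use a \<delta> in \<open>auto intro: add_nonneg_pos\<close>)
qed

text \<open>
  In contrast to the bound above, this holds for increments over the single initial point \<open>p\<close> only; the
  hypothesis gives no common Lipschitz constant for nearby initial points.
\<close>

lemma local_Lipschitz:
  assumes p: "p \<in> D"
  obtains a \<delta> L where "a > 0" "\<delta> > 0" "L > 0"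
    and "\<And>r z w B. 0 \<le> r \<Longrightarrow> r \<le> a \<Longrightarrow> continuous_on {0..r} z \<Longrightarrow> continuous_on {0..r} w \<Longrightarrow>
           z 0 = 0 \<Longrightarrow> w 0 = 0 \<Longrightarrow>
           (\<And>s. s \<in> {0..r} \<Longrightarrow> norm (z s) \<le> \<delta>) \<Longrightarrow> (\<And>s. s \<in> {0..r} \<Longrightarrow> norm (w s) \<le> \<delta>) \<Longrightarrow>
           state p z r \<in> D \<Longrightarrow> state p w r \<in> D \<Longrightarrow> (\<And>s. s \<in> {0..r} \<Longrightarrow> norm (z s - w s) \<le> B) \<Longrightarrow>
           norm (F (state p z r) - F (state p w r)) \<le> L * B"
proof -
  obtain h where h: "h > 0" "\<And>r. r \<le> h \<Longrightarrow> compact (I \<inter> {- r..0})"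
    using compact_recent_past[OF past] by blast
  obtain t \<phi> where tphi: "p = (t, \<phi>)" by (cases p)
  have *: "\<exists>T>0. \<exists>\<delta>::real. \<delta> > 0 \<and> (\<exists>L>0. \<forall>s \<phi>\<^sub>1 \<phi>\<^sub>2.
        (s, \<phi>\<^sub>1) \<in> rectangle I t \<phi> T (ereal \<delta>) \<inter> D \<longrightarrow>
        (s, \<phi>\<^sub>2) \<in> rectangle I t \<phi> T (ereal \<delta>) \<inter> D \<longrightarrow>
        compact (top_of_set I closure_of {\<theta> \<in> I. \<phi>\<^sub>1 \<theta> - \<phi>\<^sub>2 \<theta> \<noteq> 0}) \<longrightarrow>
        Lip_ineq I F L s \<phi>\<^sub>1 \<phi>\<^sub>2)"
    using bspec[OF F_Lipschitz[unfolded locally_Lipschitzian_about_prolongations_def] p]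
    unfolding tphi by simp
  obtain T \<delta> L where T: "T > 0" "(\<delta>::real) > 0" "L > 0"
    and lip: "\<And>s \<phi>\<^sub>1 \<phi>\<^sub>2. (s, \<phi>\<^sub>1) \<in> rectangle I t \<phi> T (ereal \<delta>) \<inter> D \<Longrightarrow>
        (s, \<phi>\<^sub>2) \<in> rectangle I t \<phi> T (ereal \<delta>) \<inter> D \<Longrightarrow>
        compact (top_of_set I closure_of {\<theta> \<in> I. \<phi>\<^sub>1 \<theta> - \<phi>\<^sub>2 \<theta> \<noteq> 0}) \<Longrightarrow> Lip_ineq I F L s \<phi>\<^sub>1 \<phi>\<^sub>2"
    using * by blast
  have ext: "\<phi> \<in> extensional I"
    using D_extensional p tphi by blast
  show ?thesis
  proof (rule that[of "min h T" \<delta> L])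
    fix r B and z w :: "real \<Rightarrow> 'e"
    assume r: "0 \<le> r" "r \<le> min h T"
      and z: "continuous_on {0..r} z" and w: "continuous_on {0..r} w" and zw0: "z 0 = 0" "w 0 = 0"
      and zd: "\<And>s. s \<in> {0..r} \<Longrightarrow> norm (z s) \<le> \<delta>" and wd: "\<And>s. s \<in> {0..r} \<Longrightarrow> norm (w s) \<le> \<delta>"
      and inD: "state p z r \<in> D" "state p w r \<in> D"
      and B: "\<And>s. s \<in> {0..r} \<Longrightarrow> norm (z s - w s) \<le> B"
    have "(t + r, evolve I r \<phi> z) \<in> rectangle I t \<phi> T (ereal \<delta>)"
      "(t + r, evolve I r \<phi> w) \<in> rectangle I t \<phi> T (ereal \<delta>)"
      using r zd wd by (auto intro!: evolve_in_rectangle[OF past] z w ext zw0)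
    moreover have "compact (top_of_set I closure_of {\<theta> \<in> I. evolve I r \<phi> z \<theta> - evolve I r \<phi> w \<theta> \<noteq> 0})"
      using r h(2) zw0 by (intro compact_support_diff_evolve[OF past]) auto
    ultimately have "Lip_ineq I F L (t + r) (evolve I r \<phi> z) (evolve I r \<phi> w)"
      using inD by (intro lip) (auto simp: state_def tphi)
    from Lip_ineq_evolveD[OF past this r(1)] show "norm (F (state p z r) - F (state p w r)) \<le> L * B"
      using T(3) B by (simp add: state_def tphi)
  qed (use h T in auto)
qed

end

section \<open>Solutions as increments\<close>

text \<open>
  Induction along a compact interval: a property that passes to left limits and extends a little to
  the right holds up to the end, because the infimum of the counterexamples can neither be one nor
  fail to be one.
\<close>

lemma real_interval_induct [consumes 1, case_names limit step]:
  fixes b :: real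
  assumes s: "s \<in> {0..b}"
    and limit: "\<And>s. s \<in> {0..b} \<Longrightarrow> (\<And>r. 0 \<le> r \<Longrightarrow> r < s \<Longrightarrow> P r) \<Longrightarrow> P s"
    and step: "\<And>s. 0 \<le> s \<Longrightarrow> s < b \<Longrightarrow> (\<And>r. 0 \<le> r \<Longrightarrow> r \<le> s \<Longrightarrow> P r) \<Longrightarrow>
                 \<exists>e>0. \<forall>r. s < r \<longrightarrow> r < s + e \<longrightarrow> r \<le> b \<longrightarrow> P r"
  shows "P s"
proof (rule ccontr)
  assume "\<not> P s"
  define B where "B = {r \<in> {0..b}. \<not> P r}"
  have B: "s \<in> B" "bdd_below B"
    using s \<open>\<not> P s\<close> by (auto simp: B_def bdd_below_def)
  define m where "m = Inf B"
  have m: "0 \<le> m" "m \<le> s"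
    unfolding m_def using B by (auto simp: B_def intro: cInf_lower intro!: cInf_greatest)
  have below: "P r" if "0 \<le> r" "r < m" for r
    using that m s cInf_lower[OF _ B(2), of r] by (force simp: B_def m_def)
  have Pm: "P m"
    using limit[of m] below m s by auto
  then have "m < b"
    using m s \<open>\<not> P s\<close> by (cases "m = b") auto
  moreover have "P r" if "0 \<le> r" "r \<le> m" for r
    using that below Pm by (cases "r = m") auto
  ultimately obtain e where e: "e > 0" "\<And>r. m < r \<Longrightarrow> r < m + e \<Longrightarrow> r \<le> b \<Longrightarrow> P r"
    using step[of m] m by blast
  obtain r where r: "r \<in> B" "r < m + e"
    using cInf_lessD[of B "m + e"] B e(1) by (auto simp: m_def)
  moreover have "m \<le> r"
    unfolding m_def using r B by (auto intro: cInf_lower)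
  ultimately show False
    using e(2)[of r] Pm by (cases "r = m") (auto simp: B_def)
qed

context retarded_ivp
begin

text \<open>
  Solutions in local time, represented by their increment: \<open>z s\<close> stands for \<open>x (t\<^sub>0 + s) - \<phi>\<^sub>0 0\<close>. The interval
  is closed and may degenerate to \<open>{0}\<close>, where the condition on the derivative is void.
\<close>

definition sol :: "real \<times> (real \<Rightarrow> 'e) \<Rightarrow> real \<Rightarrow> (real \<Rightarrow> 'e) \<Rightarrow> bool" where
  "sol p b z \<longleftrightarrow> z 0 = 0 \<and>
     (\<forall>s\<in>{0..b}. state p z s \<in> D \<and> (z has_vector_derivative F (state p z s)) (at s within {0..b}))"

lemma sol_zero: "sol p b z \<Longrightarrow> z 0 = 0"
  by (simp add: sol_def)

lemma sol_in_D: "sol p b z \<Longrightarrow> 0 \<le> s \<Longrightarrow> s \<le> b \<Longrightarrow> state p z s \<in> D"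
  by (simp add: sol_def)

lemma sol_derivative:
  assumes "sol p b z" "0 \<le> s" "s \<le> b" "A \<subseteq> {0..b}"
  shows "(z has_vector_derivative F (state p z s)) (at s within A)"
  using assms by (intro has_vector_derivative_within_subset[OF _ assms(4)]) (auto simp: sol_def)

lemma sol_continuous: "sol p b z \<Longrightarrow> continuous_on {0..b} z"
  by (rule continuous_on_vector_derivative[where f' = "\<lambda>s. F (state p z s)"]) (simp add: sol_def)

lemma sol_continuous_le: "sol p b z \<Longrightarrow> c \<le> b \<Longrightarrow> continuous_on {0..c} z"
  by (rule continuous_on_subset[OF sol_continuous]) auto

lemma state_orbit_limit:
  assumes p: "p \<in> D" and z: "continuous_on {0..b} z" "z 0 = 0"
    and D: "\<And>s. s \<in> {0..b} \<Longrightarrow> state p z s \<in> D" and s: "s \<in> {0..b}"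
  shows "limitin X (state p z) (state p z s) (at s within {0..b})"
proof -
  have ev: "\<forall>\<^sub>F r in at s within {0..b}. r \<in> {0..b}"
    by (simp add: eventually_at_filter)
  have b: "0 \<le> b" using s by simp
  have tr: "state p (truncate b z) r = state p z r" if "r \<in> {0..b}" for r
    using that by (intro state_truncate z) auto
  have "limitin X (\<lambda>r. state p (truncate b z) r) (state p (truncate b z) s) (at s within {0..b})"
  proof (rule state_limit)
    show "limitin X (\<lambda>r. p) p (at s within {0..b})"
      by (rule Abstract_Limits.limitin_const_iff[THEN iffD2]) (simp only: topspace_X p)
    show "\<forall>\<^sub>F r in at s within {0..b}. state p (truncate b z) r \<in> D"
      using ev by eventually_elim (simp only: tr D)
    show "state p (truncate b z) s \<in> D"
      using D s tr by metis
    show "\<forall>\<^sub>F r in at s within {0..b}. 0 \<le> r"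
      using ev by eventually_elim simp
  qed (use s z b in \<open>auto simp: truncate_apply\<close>)
  moreover have "\<forall>\<^sub>F r in at s within {0..b}. state p (truncate b z) r = state p z r"
    using ev by eventually_elim (rule tr)
  ultimately show ?thesis
    unfolding tr[OF s] by (rule limitin_transform_eventually[rotated])
qed

lemma rate_continuous:
  assumes "p \<in> D" "continuous_on {0..b} z" "z 0 = 0" "\<And>s. s \<in> {0..b} \<Longrightarrow> state p z s \<in> D"
  shows "continuous_on {0..b} (\<lambda>s. F (state p z s))"
  unfolding continuous_on_def using F_limit[OF state_orbit_limit[OF assms]] by auto

lemma sol_integral_eq:
  assumes "sol p b z" "0 \<le> s" "s \<le> b"
  shows "((\<lambda>r. F (state p z r)) has_integral z s) {0..s}"
proof -
  have "((\<lambda>r. F (state p z r)) has_integral z s - z 0) {0..s}"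
    using assms(2,3) by (intro fundamental_theorem_of_calculus sol_derivative[OF assms(1)]) auto
  then show ?thesis using sol_zero[OF assms(1)] by simp
qed

text \<open>
  The rate \<open>F \<circ> state\<close> is automatically continuous along a continuous increment, so the integral
  equation can be differentiated everywhere. In particular, every solution is continuously
  differentiable.
\<close>

lemma sol_from_integral_eq:
  assumes p: "p \<in> D" and z: "continuous_on {0..b} z" "z 0 = 0"
    and D: "\<And>s. s \<in> {0..b} \<Longrightarrow> state p z s \<in> D"
    and eq: "\<And>s. s \<in> {0..b} \<Longrightarrow> z s = integral {0..s} (\<lambda>r. F (state p z r))"
  shows "sol p b z"
  unfolding sol_def
proof (intro conjI ballI)
  fix s assume s: "s \<in> {0..b}"
  show "(z has_vector_derivative F (state p z s)) (at s within {0..b})"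
    by (rule has_vector_derivative_transform[OF s _ integral_has_vector_derivative[OF rate_continuous[OF p z D] s]])
       (simp_all add: eq)
qed (use z D in auto)

lemma sol_mono: "sol p b z \<Longrightarrow> c \<le> b \<Longrightarrow> sol p c z"
  unfolding sol_def[of p c] by (auto intro!: sol_derivative simp: sol_zero sol_in_D)

lemma sol_cong:
  assumes "sol p b z" "\<And>s. s \<in> {0..b} \<Longrightarrow> z s = w s" "0 \<le> b"
  shows "sol p b w"
proof -
  have st: "state p w s = state p z s" if "s \<in> {0..b}" for s
    using that assms(2) by (intro state_cong) auto
  show ?thesis
    unfolding sol_def
  proof (intro conjI ballI)
    show "w 0 = 0" using assms(2)[of 0] assms(3) sol_zero[OF assms(1)] by simp
    fix s assume s: "s \<in> {0..b}"
    show "state p w s \<in> D"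
      using st[OF s] assms(1) s by (simp add: sol_def)
    have "(z has_vector_derivative F (state p w s)) (at s within {0..b})"
      using st[OF s] assms(1) s by (simp add: sol_def)
    then show "(w has_vector_derivative F (state p w s)) (at s within {0..b})"
      by (rule has_vector_derivative_transform[OF s, rotated]) (simp add: assms(2))
  qed
qed

lemma sol_at_zero: "p \<in> D \<Longrightarrow> sol p 0 (\<lambda>_. 0)"
  by (simp add: sol_def state_0 has_vector_derivative_def has_derivative_within_singleton_iff bounded_linear_scaleR_left)

lemma sol_shift:
  assumes z: "sol p b z" and c: "0 \<le> c" "c \<le> b"
  shows "sol (state p z c) (b - c) (\<lambda>u. z (c + u) - z c)"
  unfolding sol_def
proof (intro conjI ballI)
  fix s assume s: "s \<in> {0..b - c}"
  have st: "state (state p z c) (\<lambda>u. z (c + u) - z c) s = state p z (c + s)"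
    using s c by (intro state_shifted_increment) auto
  show "state (state p z c) (\<lambda>u. z (c + u) - z c) s \<in> D"
    unfolding st using z c s by (intro sol_in_D) auto
  have "(z has_vector_derivative F (state p z (c + s))) (at (c + s) within {0..b})"
    using z c s unfolding sol_def by auto
  then have "(z has_vector_derivative F (state p z (c + s))) (at (c + s) within ((+) c ` {0..b - c}))"
    by (rule has_vector_derivative_within_subset) (use c in auto)
  moreover have "((+) c has_vector_derivative 1) (at s within {0..b - c})"
    by (auto intro!: derivative_eq_intros)
  ultimately have "((z \<circ> (+) c) has_vector_derivative 1 *\<^sub>R F (state p z (c + s))) (at s within {0..b - c})"
    by (intro vector_diff_chain_within)
  then show "((\<lambda>u. z (c + u) - z c) has_vector_derivative F (state (state p z c) (\<lambda>u. z (c + u) - z c) s))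
       (at s within {0..b - c})"
    unfolding st by (auto intro!: derivative_eq_intros simp: o_def)
qed simp

text \<open>
  Gluing is done on the level of the integral equation, where the one-sided derivatives at the junction
  need no separate treatment.
\<close>

lemma sol_concat:
  assumes p: "p \<in> D" and z: "sol p c z" and w: "sol (state p z c) d w" and cd: "0 \<le> c" "0 \<le> d"
  shows "sol p (c + d) (\<lambda>u. if u \<le> c then z u else z c + w (u - c))" (is "sol p _ ?v")
proof -
  have st1: "state p ?v s = state p z s" if "s \<in> {0..c}" for s
    using that by (intro state_cong) auto
  have st2: "state p ?v s = state (state p z c) w (s - c)" if "s \<in> {c..c + d}" for s
    using state_state[OF cd(1), of "s - c" w p z] that sol_zero[OF w] by simp
  have D: "state p ?v s \<in> D" if "s \<in> {0..c + d}" for s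
  proof (cases "s \<le> c")
    case True then show ?thesis using st1[of s] z that by (simp add: sol_in_D)
  next
    case False then show ?thesis using st2[of s] w that by (simp add: sol_in_D)
  qed
  have v0: "?v 0 = 0" using sol_zero[OF z] cd by simp
  have cont: "continuous_on {0..c + d} ?v"
  proof -
    have "continuous_on ({0..c} \<union> {c..c + d}) ?v"
      using sol_continuous[OF z] sol_continuous[OF w] sol_zero[OF w]
      by (intro continuous_on_cases)
         (auto intro!: continuous_intros continuous_on_compose2[OF sol_continuous[OF w]])
    moreover have "{0..c} \<union> {c..c + d} = {0..c + d}" using cd by auto
    ultimately show ?thesis by simp
  qed
  have int1: "((\<lambda>r. F (state p ?v r)) has_integral z s) {0..s}" if "s \<in> {0..c}" for s
    by (rule has_integral_eq[OF _ sol_integral_eq[OF z]]) (use that st1 in auto)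
  have int2: "((\<lambda>r. F (state p ?v r)) has_integral w (s - c)) {c..s}" if "s \<in> {c..c + d}" for s
  proof -
    have "((\<lambda>r. F (state (state p z c) w r)) has_integral w (s - c)) {0..s - c}"
      using that by (intro sol_integral_eq[OF w]) auto
    from has_integral_affinity[where m=1 and c="-c", OF this[folded cbox_interval]]
    have "((\<lambda>r. F (state (state p z c) w (r - c))) has_integral w (s - c)) {c..s}"
      using that by simp
    then show ?thesis
      by (rule has_integral_eq[rotated]) (use that st2 in auto)
  qed
  have "?v s = integral {0..s} (\<lambda>r. F (state p ?v r))" if "s \<in> {0..c + d}" for s
  proof (cases "s \<le> c")
    case True
    then show ?thesis using int1[of s] that by (auto intro: integral_unique[symmetric])
  next
    case False
    have "((\<lambda>r. F (state p ?v r)) has_integral z c + w (s - c)) {0..s}"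
      using has_integral_combine[OF cd(1) _ int1[of c] int2[of s]] False that cd by auto
    then show ?thesis using False by (auto dest: integral_unique)
  qed
  then show ?thesis
    by (intro sol_from_integral_eq[OF p cont v0 D])
qed

end

section \<open>Uniqueness, local existence and lifetimes\<close>

lemma norm_has_integral_le:
  fixes f :: "real \<Rightarrow> 'a::real_normed_vector"
  assumes "(f has_integral i) {0..s}" "0 \<le> s" "\<And>r. r \<in> {0..s} \<Longrightarrow> norm (f r) \<le> B"
  shows "norm i \<le> B * s"
proof -
  have "0 \<le> B" using assms(2) order_trans[OF norm_ge_zero assms(3)[of 0]] by simp
  from has_integral_bound_real[OF this finite.emptyI assms(1)] show ?thesis
    using assms(2,3) by simp
qed

context retarded_ivp
begin

text \<open>
  Constants valid near \<open>p\<close>: the bound \<open>M\<close> for \<open>F\<close> is uniform over the initial points in \<open>U\<close>, the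
  Lipschitz constant \<open>L\<close> refers to \<open>p\<close> alone. The condition \<open>a * M < \<delta>\<close> keeps solutions inside the rectangle
  where both are valid, and \<open>a * L \<le> 1 / 2\<close> makes the integral operator a contraction.
\<close>

definition local_data ::
    "real \<times> (real \<Rightarrow> 'e) \<Rightarrow> (real \<times> (real \<Rightarrow> 'e)) set \<Rightarrow> real \<Rightarrow> real \<Rightarrow> real \<Rightarrow> real \<Rightarrow> bool" where
  "local_data p U a \<delta> M L \<longleftrightarrow>
     openin X U \<and> p \<in> U \<and> a > 0 \<and> \<delta> > 0 \<and> M > 0 \<and> L > 0 \<and> a * M < \<delta> \<and> a * L \<le> 1 / 2 \<and>
     (\<forall>q r z. q \<in> U \<longrightarrow> 0 \<le> r \<longrightarrow> r \<le> a \<longrightarrow> continuous_on {0..r} z \<longrightarrow> z 0 = 0 \<longrightarrow>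
        (\<forall>s\<in>{0..r}. norm (z s) \<le> \<delta>) \<longrightarrow> state q z r \<in> D \<and> norm (F (state q z r)) \<le> M) \<and>
     (\<forall>r z w B. 0 \<le> r \<longrightarrow> r \<le> a \<longrightarrow> continuous_on {0..r} z \<longrightarrow> continuous_on {0..r} w \<longrightarrow>
        z 0 = 0 \<longrightarrow> w 0 = 0 \<longrightarrow> (\<forall>s\<in>{0..r}. norm (z s) \<le> \<delta>) \<longrightarrow> (\<forall>s\<in>{0..r}. norm (w s) \<le> \<delta>) \<longrightarrow>
        (\<forall>s\<in>{0..r}. norm (z s - w s) \<le> B) \<longrightarrow>
        norm (F (state p z r) - F (state p w r)) \<le> L * B)"

lemma local_dataD:
  assumes "local_data p U a \<delta> M L"
  shows "openin X U" "p \<in> U" "a > 0" "\<delta> > 0" "M > 0" "L > 0" "a * M < \<delta>" "a * L \<le> 1 / 2"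
  using assms unfolding local_data_def by blast+

lemma local_data_bound:
  assumes "local_data p U a \<delta> M L"
    and "q \<in> U" "0 \<le> r" "r \<le> a" "continuous_on {0..r} z" "z 0 = 0" "\<And>s. s \<in> {0..r} \<Longrightarrow> norm (z s) \<le> \<delta>"
  shows "state q z r \<in> D" "norm (F (state q z r)) \<le> M"
  using assms unfolding local_data_def by blast+

lemma local_data_Lipschitz:
  assumes "local_data p U a \<delta> M L"
    and "0 \<le> r" "r \<le> a" "continuous_on {0..r} z" "continuous_on {0..r} w" "z 0 = 0" "w 0 = 0"
    and "\<And>s. s \<in> {0..r} \<Longrightarrow> norm (z s) \<le> \<delta>" "\<And>s. s \<in> {0..r} \<Longrightarrow> norm (w s) \<le> \<delta>"
    and "\<And>s. s \<in> {0..r} \<Longrightarrow> norm (z s - w s) \<le> B"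
  shows "norm (F (state p z r) - F (state p w r)) \<le> L * B"
  using assms unfolding local_data_def by blast

lemma local_data_exists:
  assumes p: "p \<in> D"
  obtains U a \<delta> M L where "local_data p U a \<delta> M L"
proof -
  obtain U a1 \<delta>1 M where U: "openin X U" "p \<in> U" and pos1: "a1 > 0" "\<delta>1 > 0" "M > 0"
    and bound: "\<And>q r z. q \<in> U \<Longrightarrow> 0 \<le> r \<Longrightarrow> r \<le> a1 \<Longrightarrow> continuous_on {0..r} z \<Longrightarrow> z 0 = 0 \<Longrightarrow>
           (\<And>s. s \<in> {0..r} \<Longrightarrow> norm (z s) \<le> \<delta>1) \<Longrightarrow> state q z r \<in> D \<and> norm (F (state q z r)) \<le> M"
    using local_bound[OF p] by blast
  obtain a2 \<delta>2 L where pos2: "a2 > 0" "\<delta>2 > 0" "L > 0"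
    and lip: "\<And>r z w B. 0 \<le> r \<Longrightarrow> r \<le> a2 \<Longrightarrow> continuous_on {0..r} z \<Longrightarrow> continuous_on {0..r} w \<Longrightarrow>
           z 0 = 0 \<Longrightarrow> w 0 = 0 \<Longrightarrow>
           (\<And>s. s \<in> {0..r} \<Longrightarrow> norm (z s) \<le> \<delta>2) \<Longrightarrow> (\<And>s. s \<in> {0..r} \<Longrightarrow> norm (w s) \<le> \<delta>2) \<Longrightarrow>
           state p z r \<in> D \<Longrightarrow> state p w r \<in> D \<Longrightarrow> (\<And>s. s \<in> {0..r} \<Longrightarrow> norm (z s - w s) \<le> B) \<Longrightarrow>
           norm (F (state p z r) - F (state p w r)) \<le> L * B"
    using local_Lipschitz[OF p] by blast
  define \<delta> where "\<delta> = min \<delta>1 \<delta>2"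
  define a where "a = min (min a1 a2) (min (\<delta> / (2 * M)) (1 / (2 * L)))"
  have \<delta>: "\<delta> > 0" "\<delta> \<le> \<delta>1" "\<delta> \<le> \<delta>2" using pos1 pos2 by (auto simp: \<delta>_def)
  have a: "a > 0" "a \<le> a1" "a \<le> a2" "a \<le> \<delta> / (2 * M)" "a \<le> 1 / (2 * L)"
    using pos1 pos2 \<delta>(1) by (auto simp: a_def)
  have "a * M \<le> \<delta> / 2" "a * L \<le> 1 / 2"
    using a(4,5) pos1 pos2 by (auto simp: field_simps)
  then have aM: "a * M < \<delta>" "a * L \<le> 1 / 2" using \<delta>(1) by auto
  have bound': "state q z r \<in> D \<and> norm (F (state q z r)) \<le> M"
    if "q \<in> U" "0 \<le> r" "r \<le> a" "continuous_on {0..r} z" "z 0 = 0" "\<And>s. s \<in> {0..r} \<Longrightarrow> norm (z s) \<le> \<delta>" for q r z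
    using that(6) a \<delta> by (intro bound that(1,2,4,5)) (use that(3) in \<open>auto intro: order_trans\<close>)
  have lip': "norm (F (state p z r) - F (state p w r)) \<le> L * B"
    if r: "0 \<le> r" "r \<le> a" and zw: "continuous_on {0..r} z" "continuous_on {0..r} w" "z 0 = 0" "w 0 = 0"
      and zd: "\<And>s. s \<in> {0..r} \<Longrightarrow> norm (z s) \<le> \<delta>" and wd: "\<And>s. s \<in> {0..r} \<Longrightarrow> norm (w s) \<le> \<delta>"
      and B: "\<And>s. s \<in> {0..r} \<Longrightarrow> norm (z s - w s) \<le> B" for r z w B
    proof (rule lip[OF r(1) _ zw _ _ _ _ B])
      show "r \<le> a2" using r a by simp
      show "norm (z s) \<le> \<delta>2" "norm (w s) \<le> \<delta>2" if "s \<in> {0..r}" for s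
        using zd[OF that] wd[OF that] \<delta>(3) by auto
      show "state p z r \<in> D" using bound'[OF U(2) r zw(1,3) zd] by blast
      show "state p w r \<in> D" using bound'[OF U(2) r zw(2,4) wd] by blast
    qed
  show ?thesis
    by (rule that[of U a \<delta> M L], unfold local_data_def)
       (intro conjI allI impI U a(1) \<delta>(1) pos1(3) pos2(3) aM; use bound' lip' in simp)
qed

lemma small_near_0:
  fixes z :: "real \<Rightarrow> 'e"
  assumes "continuous_on {0..b} z" "z 0 = 0" "0 < b" "\<delta> > 0"
  obtains c where "0 < c" "c \<le> b" "\<And>s. s \<in> {0..c} \<Longrightarrow> norm (z s) \<le> \<delta>"
proof -
  obtain d where d: "d > 0" "\<And>s. s \<in> {0..b} \<Longrightarrow> dist s 0 < d \<Longrightarrow> dist (z s) (z 0) < \<delta>"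
    using assms(1,3,4) unfolding continuous_on_iff by (metis atLeastAtMost_iff less_eq_real_def)
  show ?thesis
    by (rule that[of "min b (d / 2)"]) (use d assms in \<open>auto simp: dist_norm intro!: less_imp_le\<close>)
qed

text \<open>
  The difference of two solutions is bounded by half its own supremum on a short interval.
\<close>

lemma local_uniqueness:
  assumes p: "p \<in> D" and z: "sol p b z" and w: "sol p b w" and b: "0 < b"
  obtains c where "0 < c" "c \<le> b" "\<And>s. s \<in> {0..c} \<Longrightarrow> z s = w s"
proof -
  obtain U a \<delta> M L where ld: "local_data p U a \<delta> M L"
    using local_data_exists[OF p] .
  note pos = local_dataD(3-8)[OF ld]
  obtain c1 where c1: "0 < c1" "c1 \<le> b" "\<And>s. s \<in> {0..c1} \<Longrightarrow> norm (z s) \<le> \<delta>"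
    using small_near_0[OF sol_continuous[OF z] sol_zero[OF z] b pos(2)] by blast
  obtain c2 where c2: "0 < c2" "c2 \<le> b" "\<And>s. s \<in> {0..c2} \<Longrightarrow> norm (w s) \<le> \<delta>"
    using small_near_0[OF sol_continuous[OF w] sol_zero[OF w] b pos(2)] by blast
  define c where "c = min a (min c1 c2)"
  have c: "0 < c" "c \<le> b" "c \<le> a" "c \<le> c1" "c \<le> c2"
    using c1 c2 pos by (auto simp: c_def)
  have cz: "continuous_on {0..r} z" and cw: "continuous_on {0..r} w" if "r \<le> c" for r
    using that c sol_continuous_le[OF z] sol_continuous_le[OF w] by auto
  define B where "B = dist (truncate c z) (truncate c w)"
  have B: "norm (z s - w s) \<le> B" if "s \<in> {0..c}" for s
    using dist_bounded[of "truncate c z" s "truncate c w"] that c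
    by (simp add: truncate_apply cz cw B_def dist_norm)
  have "B \<le> B / 2"
    unfolding B_def
  proof (rule dist_truncate_le)
    fix s assume s: "s \<in> {0..c}"
    have "norm (z s - w s) \<le> L * B * s"
    proof (rule norm_has_integral_le)
      show "((\<lambda>r. F (state p z r) - F (state p w r)) has_integral z s - w s) {0..s}"
        using s c by (intro has_integral_diff sol_integral_eq[OF z] sol_integral_eq[OF w]) auto
      fix r assume r: "r \<in> {0..s}"
      show "norm (F (state p z r) - F (state p w r)) \<le> L * B"
        using r s c c1 c2 by (intro local_data_Lipschitz[OF ld] cz cw B sol_zero[OF z] sol_zero[OF w]) auto
    qed (use s in simp)
    also have "\<dots> \<le> L * B * a"
      using s c pos by (intro mult_left_mono) (auto simp: B_def)
    also have "\<dots> \<le> B / 2"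
      using mult_right_mono[OF pos(6), of B] by (simp add: B_def mult_ac)
    finally show "norm (z s - w s) \<le> dist (truncate c z) (truncate c w) / 2"
      by (simp add: B_def)
  qed (use c cz cw in auto)
  then have "z s = w s" if "s \<in> {0..c}" for s
    using order_trans[OF B[OF that], of 0] by simp
  then show ?thesis using that c by blast
qed

text \<open>
  The Lipschitz condition is imposed around every point of the domain, hence also around the last state
  up to which two solutions agree.
\<close>

lemma uniqueness:
  assumes p: "p \<in> D" and z: "sol p b z" and w: "sol p b w" and s: "s \<in> {0..b}"
  shows "z s = w s"
  using s
proof (induction rule: real_interval_induct)
  case (limit s)
  show ?case
  proof (cases "s = 0")
    case True then show ?thesis using sol_zero[OF z] sol_zero[OF w] by simp
  next
    case False
    then have cl: "closure {0..<s} = {0..s}" using limit by (simp add: closure_atLeastLessThan)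
    have "z s - w s = 0"
    proof (rule continuous_constant_on_closure[of "{0..<s}" "\<lambda>r. z r - w r"])
      show "continuous_on (closure {0..<s}) (\<lambda>r. z r - w r)"
        unfolding cl using limit by (intro continuous_on_diff sol_continuous_le[OF z] sol_continuous_le[OF w]) auto
    qed (use limit cl in auto)
    then show ?thesis by simp
  qed
next
  case (step s)
  have st: "state p w s = state p z s"
    using step by (intro state_cong) auto
  have zs: "sol (state p z s) (b - s) (\<lambda>u. z (s + u) - z s)"
    using step by (intro sol_shift[OF z]) auto
  have ws: "sol (state p z s) (b - s) (\<lambda>u. w (s + u) - w s)"
    using sol_shift[OF w, of s] step st by simp
  have "state p z s \<in> D" using step by (intro sol_in_D[OF z]) auto
  then obtain c where c: "0 < c" "\<And>u. u \<in> {0..c} \<Longrightarrow> z (s + u) - z s = w (s + u) - w s"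
    using local_uniqueness[OF _ zs ws] step by (metis diff_gt_0_iff_gt)
  show ?case
  proof (intro exI conjI allI impI)
    show "c > 0" by fact
    fix r assume "s < r" "r < s + c"
    then show "z r = w r" using c(2)[of "r - s"] step(3)[of s] step(1) by simp
  qed
qed

text \<open>
  Picard iteration on the closed \<open>\<delta>\<close>-ball of increments vanishing at \<open>0\<close>.
\<close>

lemma local_existence:
  assumes p: "p \<in> D"
  obtains b z where "0 < b" "sol p b z"
proof -
  obtain U a \<delta> M L where ld: "local_data p U a \<delta> M L"
    using local_data_exists[OF p] .
  note pos = local_dataD(3-8)[OF ld]
  define C where "C = PiC {0} (\<lambda>_. {0}) \<inter> cball (0 :: real \<Rightarrow>\<^sub>C 'e) \<delta>"
  have C_iff: "z \<in> C \<longleftrightarrow> apply_bcontfun z 0 = 0 \<and> norm z \<le> \<delta>" for z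
    by (auto simp: C_def mem_PiC_iff)
  have small: "norm (apply_bcontfun z s) \<le> \<delta>" if "z \<in> C" for z s
    using norm_bounded[of z s] that by (auto simp: C_iff)
  have "complete C"
    unfolding complete_eq_closed C_def by (intro closed_Int closed_PiC closed_cball) auto
  have "0 \<in> C" using pos by (simp add: C_iff)
  define P where "P z s = integral {0..s} (\<lambda>r. F (state p (apply_bcontfun z) r))" for z s
  have D: "state p z s \<in> D" and M: "norm (F (state p z s)) \<le> M" if "z \<in> C" "s \<in> {0..a}" for z s
    using local_data_bound[OF ld local_dataD(2)[OF ld], of s z] that small[OF that(1)] by (auto simp: C_iff)
  have rate: "continuous_on {0..a} (\<lambda>s. F (state p z s))" if "z \<in> C" for z
    using that D[OF that] by (intro rate_continuous p) (auto simp: C_iff)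
  have int: "((\<lambda>r. F (state p z r)) has_integral P z s) {0..s}" if "z \<in> C" "s \<in> {0..a}" for z s
    unfolding P_def using that
    by (intro integrable_integral integrable_continuous_real continuous_on_subset[OF rate]) auto
  have P0: "P z 0 = 0" for z by (simp add: P_def)
  have Pc: "continuous_on {0..a} (P z)" if "z \<in> C" for z
    unfolding P_def using rate[OF that]
    by (intro indefinite_integral_continuous_1 integrable_continuous_real)
  have maps: "truncate a (P z) \<in> C" if z: "z \<in> C" for z
  proof -
    have "norm (P z s) \<le> \<delta>" if s: "s \<in> {0..a}" for s
    proof -
      have "norm (P z s) \<le> M * s"
        by (rule norm_has_integral_le[OF int[OF z s]]) (use s M[OF z] in auto)
      also have "\<dots> \<le> M * a" using s pos by (intro mult_left_mono) auto
      finally show ?thesis using pos by (simp add: mult.commute)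
    qed
    then show ?thesis
      unfolding C_iff using pos P0 Pc[OF z] by (auto intro!: norm_truncate_le simp: truncate_apply)
  qed
  have contraction: "dist (truncate a (P z)) (truncate a (P w)) \<le> 1 / 2 * dist z w" if zw: "z \<in> C" "w \<in> C" for z w
  proof (rule dist_truncate_le)
    fix s assume s: "s \<in> {0..a}"
    have "norm (P z s - P w s) \<le> (L * dist z w) * s"
    proof (rule norm_has_integral_le)
      show "((\<lambda>r. F (state p z r) - F (state p w r)) has_integral P z s - P w s) {0..s}"
        by (intro has_integral_diff int zw s)
      fix r assume "r \<in> {0..s}"
      then show "norm (F (state p z r) - F (state p w r)) \<le> L * dist z w"
        using s zw by (intro local_data_Lipschitz[OF ld] small) (auto simp: C_iff dist_bounded dist_norm[symmetric])
    qed (use s in simp)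
    also have "\<dots> \<le> (L * dist z w) * a"
      using s pos by (intro mult_left_mono) auto
    also have "\<dots> \<le> 1 / 2 * dist z w"
      using mult_right_mono[OF pos(6), of "dist z w"] by (simp add: mult_ac)
    finally show "norm (P z s - P w s) \<le> 1 / 2 * dist z w" .
  qed (use pos Pc zw in auto)
  have "\<exists>!z. z \<in> C \<and> truncate a (P z) = z"
    by (rule Banach_fix[OF \<open>complete C\<close>, of "1 / 2"]) (use \<open>0 \<in> C\<close> maps contraction in auto)
  then obtain z where z: "z \<in> C" "truncate a (P z) = z" by blast
  have eq: "apply_bcontfun z s = P z s" if "s \<in> {0..a}" for s
    using truncate_apply[OF _ Pc[OF z(1)], of s] pos that z(2) by simp
  have "sol p a z"
    by (rule sol_from_integral_eq[OF p]) (use z(1) D eq in \<open>auto simp: C_iff P_def\<close>)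
  then show ?thesis using that pos by blast
qed

definition lifetimes :: "real \<times> (real \<Rightarrow> 'e) \<Rightarrow> real set" where
  "lifetimes p = {b. 0 \<le> b \<and> (\<exists>z. sol p b z)}"

text \<open>
  The increment of the solution from \<open>p\<close>. By uniqueness the choice of the solution is immaterial, and
  choosing it for each \<open>s\<close> separately yields one function that works for all lifetimes at once.
\<close>

definition increment :: "real \<times> (real \<Rightarrow> 'e) \<Rightarrow> real \<Rightarrow> 'e" where
  "increment p s = (SOME z. sol p s z) s"

lemma increment_eq:
  assumes "p \<in> D" "sol p b z" "0 \<le> s" "s \<le> b" shows "increment p s = z s"
proof -
  have z: "sol p s z" using assms sol_mono by blast
  then have "sol p s (SOME z. sol p s z)" by (rule someI[of "sol p s"])
  from uniqueness[OF assms(1) this z, of s] show ?thesis using assms by (simp add: increment_def)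
qed

lemma sol_increment:
  assumes "p \<in> D" "b \<in> lifetimes p" shows "sol p b (increment p)"
proof -
  obtain z where z: "sol p b z" "0 \<le> b" using assms(2) by (auto simp: lifetimes_def)
  show ?thesis
    by (rule sol_cong[OF z(1) _ z(2)], rule sym, rule increment_eq[OF assms(1) z(1)]) simp_all
qed

lemma lifetimesI: "sol p b z \<Longrightarrow> 0 \<le> b \<Longrightarrow> b \<in> lifetimes p"
  by (auto simp: lifetimes_def)

lemma lifetimes_nonneg: "b \<in> lifetimes p \<Longrightarrow> 0 \<le> b"
  by (simp add: lifetimes_def)

lemma lifetimes_downward: "b \<in> lifetimes p \<Longrightarrow> 0 \<le> c \<Longrightarrow> c \<le> b \<Longrightarrow> c \<in> lifetimes p"
  using sol_mono[of p b] by (auto simp: lifetimes_def)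

lemma zero_in_lifetimes: "p \<in> D \<Longrightarrow> 0 \<in> lifetimes p"
  by (rule lifetimesI[OF sol_at_zero]) auto

abbreviation flow :: "real \<Rightarrow> real \<times> (real \<Rightarrow> 'e) \<Rightarrow> real \<times> (real \<Rightarrow> 'e)" where
  "flow s p \<equiv> state p (increment p) s"

lemma increment_0: "p \<in> D \<Longrightarrow> increment p 0 = 0"
  using sol_zero[OF sol_increment[OF _ zero_in_lifetimes]] .

lemma flow_0: "p \<in> D \<Longrightarrow> flow 0 p = p"
  by (simp add: state_0 increment_0)

lemma flow_in_D: "p \<in> D \<Longrightarrow> s \<in> lifetimes p \<Longrightarrow> flow s p \<in> D"
  using sol_in_D[OF sol_increment] lifetimes_nonneg by blast

lemma lifetimes_add:
  assumes p: "p \<in> D" and c: "c \<in> lifetimes p" and d: "d \<in> lifetimes (flow c p)"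
  shows "c + d \<in> lifetimes p" "increment p (c + d) = increment p c + increment (flow c p) d" "flow (c + d) p = flow d (flow c p)"
proof -
  have nn: "0 \<le> c" "0 \<le> d" using c d lifetimes_nonneg by auto
  note q = flow_in_D[OF p c]
  define v where "v = (\<lambda>u. if u \<le> c then increment p u else increment p c + increment (flow c p) (u - c))"
  have v: "sol p (c + d) v"
    unfolding v_def by (rule sol_concat[OF p sol_increment[OF p c] sol_increment[OF q d] nn])
  show cd: "c + d \<in> lifetimes p" by (rule lifetimesI[OF v]) (use nn in simp)
  have "increment p (c + d) = v (c + d)" by (rule increment_eq[OF p v]) (use nn in auto)
  also have "\<dots> = increment p c + increment (flow c p) d"
    using nn increment_0[OF q] by (cases "d = 0") (auto simp: v_def)
  finally show "increment p (c + d) = increment p c + increment (flow c p) d" .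
  have "flow d (flow c p) = state p v (c + d)"
    unfolding v_def using state_state[OF nn, of "increment (flow c p)"] increment_0[OF q] by simp
  also have "\<dots> = flow (c + d) p"
    by (rule state_cong) (use nn increment_eq[OF p v] in auto)
  finally show "flow (c + d) p = flow d (flow c p)" by simp
qed

text \<open>
  No lifetime is the largest one, so the maximal interval of existence is open on the right.
\<close>

lemma lifetimes_open:
  assumes p: "p \<in> D" and b: "b \<in> lifetimes p"
  obtains e where "e > 0" "b + e \<in> lifetimes p"
proof -
  obtain e z where e: "0 < e" "sol (flow b p) e z"
    using local_existence[OF flow_in_D[OF p b]] by blast
  then have "e \<in> lifetimes (flow b p)" by (intro lifetimesI) auto
  then show ?thesis using lifetimes_add(1)[OF p b] that e(1) by blast
qed

end

section \<open>Solutions from nearby initial points\<close>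

text \<open>
  A compact set that contains, frozen outside \<open>{0..a}\<close>, every increment along which \<open>norm F \<le> M\<close>.
\<close>

definition Lipschitz_increments :: "real \<Rightarrow> real \<Rightarrow> (real \<Rightarrow>\<^sub>C 'e::real_normed_vector) set" where
  "Lipschitz_increments M a = {z. apply_bcontfun z 0 = 0 \<and>
     (\<forall>s t. dist (apply_bcontfun z s) (apply_bcontfun z t) \<le> M * dist s t) \<and>
     (\<forall>s. apply_bcontfun z s = apply_bcontfun z (max 0 (min s a)))}"

lemma tendsto_bcontfun_apply:
  fixes f :: "'i \<Rightarrow> 'a::topological_space \<Rightarrow>\<^sub>C 'b::metric_space"
  assumes "(f \<longlongrightarrow> l) \<F>" shows "((\<lambda>i. apply_bcontfun (f i) x) \<longlongrightarrow> apply_bcontfun l x) \<F>"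
  using tendsto_bcontfun_uniform_limit[OF assms] by (rule tendsto_uniform_limitI) simp

text \<open>
  By Arzela--Ascoli; this is where the finite dimension of the range is used.
\<close>

lemma compact_Lipschitz_increments:
  assumes a: "0 < a" and M: "0 < M"
  shows "compact (Lipschitz_increments M a :: (real \<Rightarrow>\<^sub>C 'e::euclidean_space) set)"
  unfolding compact_eq_seq_compact_metric seq_compact_def
proof (intro allI impI)
  fix f :: "nat \<Rightarrow> real \<Rightarrow>\<^sub>C 'e"
  assume "\<forall>n. f n \<in> Lipschitz_increments M a"
  then have f0: "f n 0 = 0" and fM: "dist (f n s) (f n t) \<le> M * dist s t"
    and fc: "f n s = f n (max 0 (min s a))" for n s t
    unfolding Lipschitz_increments_def by blast+
  obtain g k where g: "continuous_on {0..a} g" and k: "strict_mono (k :: nat \<Rightarrow> nat)"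
    and lim: "\<And>e. 0 < e \<Longrightarrow> \<exists>N. \<forall>n x. n \<ge> N \<and> x \<in> {0..a} \<longrightarrow> norm (f (k n) x - g x) < e"
  proof (rule Arzela_Ascoli[of "{0..a}" "\<lambda>n. apply_bcontfun (f n)" "M * a"])
    show "norm (f n x) \<le> M * a" if "x \<in> {0..a}" for n x
    proof -
      have "norm (f n x) \<le> M * x" using fM[of n x 0] f0[of n] that by (simp add: dist_norm)
      also have "\<dots> \<le> M * a" using that M by (intro mult_left_mono) auto
      finally show ?thesis .
    qed
    show "\<exists>d>0. \<forall>n y. y \<in> {0..a} \<and> norm (x - y) < d \<longrightarrow> norm (f n x - f n y) < e" if "0 < e" for x e
    proof (intro exI[of _ "e / M"] conjI allI impI)
      show "0 < e / M" using that M by simp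
      fix n y assume "y \<in> {0..a} \<and> norm (x - y) < e / M"
      then have "M * norm (x - y) < e" using M by (simp add: field_simps)
      then show "norm (f n x - f n y) < e" using fM[of n x y] by (simp add: dist_norm)
    qed
  qed auto
  define l where "l = truncate a g"
  have l: "apply_bcontfun l s = g (max 0 (min s a))" for s
    unfolding l_def using a g by (intro truncate_apply) auto
  have flim: "(\<lambda>n. f (k n)) \<longlonglongrightarrow> l"
  proof (rule metric_LIMSEQ_I)
    fix e :: real assume "0 < e"
    then obtain N where N: "\<And>n x. n \<ge> N \<Longrightarrow> x \<in> {0..a} \<Longrightarrow> norm (f (k n) x - g x) < e / 2"
      using lim[of "e / 2"] by auto
    have "dist (f (k n)) l < e" if "n \<ge> N" for n
    proof -
      have "dist (f (k n)) l \<le> e / 2"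
      proof (rule dist_bound)
        fix s
        have "max 0 (min s a) \<in> {0..a}" using a by auto
        from N[OF that this] show "dist (f (k n) s) (l s) \<le> e / 2"
          unfolding l fc[of "k n" s] by (simp add: dist_norm)
      qed
      then show ?thesis using \<open>0 < e\<close> by simp
    qed
    then show "\<exists>N. \<forall>n\<ge>N. dist (f (k n)) l < e" by blast
  qed
  have pt: "(\<lambda>n. f (k n) s) \<longlonglongrightarrow> l s" for s
    by (rule tendsto_bcontfun_apply[OF flim])
  have "l 0 = 0" using LIMSEQ_unique[OF pt[of 0]] f0 by simp
  moreover have "dist (l s) (l t) \<le> M * dist s t" for s t
    by (rule LIMSEQ_le_const2[OF tendsto_dist[OF pt pt]]) (use fM in blast)
  moreover have "l s = l (max 0 (min s a))" for s
    using a by (simp add: l)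
  ultimately have "l \<in> Lipschitz_increments M a"
    unfolding Lipschitz_increments_def by blast
  then show "\<exists>l\<in>Lipschitz_increments M a. \<exists>r. strict_mono r \<and> (f \<circ> r) \<longlonglongrightarrow> l"
    using k flim unfolding comp_def by blast
qed

lemma truncate_Lipschitz_increments:
  fixes z :: "real \<Rightarrow> 'e::real_normed_vector"
  assumes a: "0 \<le> a" and M: "0 \<le> M" and z: "continuous_on {0..a} z" "z 0 = 0"
    and lip: "\<And>s t. 0 \<le> s \<Longrightarrow> s \<le> t \<Longrightarrow> t \<le> a \<Longrightarrow> norm (z t - z s) \<le> M * (t - s)"
  shows "truncate a z \<in> Lipschitz_increments M a"
proof -
  have ordered: "norm (z (max 0 (min t a)) - z (max 0 (min s a))) \<le> M * \<bar>t - s\<bar>" if "s \<le> t" for s t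
  proof -
    have "norm (z (max 0 (min t a)) - z (max 0 (min s a))) \<le> M * (max 0 (min t a) - max 0 (min s a))"
      using a that by (intro lip) auto
    also have "\<dots> \<le> M * \<bar>t - s\<bar>" using M that by (intro mult_left_mono) auto
    finally show ?thesis .
  qed
  have "dist (truncate a z s) (truncate a z t) \<le> M * dist s t" for s t
    using ordered[of s t] ordered[of t s]
    by (cases "s \<le> t") (auto simp: truncate_apply[OF a z(1)] dist_norm norm_minus_commute abs_minus_commute)
  then show ?thesis
    unfolding Lipschitz_increments_def using a z by (simp add: truncate_apply)
qed

lemma eventually_limitin_nhdsin:
  assumes "limitin X q p \<F>" "\<forall>\<^sub>F x in nhdsin X p. P x"
  shows "\<forall>\<^sub>F i in \<F>. P (q i)"
proof -
  obtain S where S: "openin X S" "p \<in> S" "\<And>x. x \<in> S \<Longrightarrow> P x"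
    using assms limitin_topspace[OF assms(1)] by (auto simp: eventually_nhdsin)
  from limitinD[OF assms(1) S(1,2)] show ?thesis by eventually_elim (rule S(3))
qed

context retarded_ivp
begin

lemma local_data_in_D: "local_data p U a \<delta> M L \<Longrightarrow> q \<in> U \<Longrightarrow> q \<in> D"
  using openin_subset[OF local_dataD(1)] topspace_X by blast

text \<open>
  As long as the increment has norm at most \<open>\<delta>\<close> the rate is bounded by \<open>M\<close>, and \<open>M * s < \<delta>\<close> for \<open>s \<le> a\<close>,
  so the solution cannot leave the ball before time \<open>a\<close>.
\<close>

lemma sol_growth:
  assumes ld: "local_data p U a \<delta> M L" and q: "q \<in> U" and z: "sol q b z" and b: "b \<le> a" and s: "s \<in> {0..b}"
  shows "norm (z s) \<le> M * s"
  using s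
proof (induction rule: real_interval_induct)
  case (limit s)
  show ?case
  proof (cases "s = 0")
    case True then show ?thesis using sol_zero[OF z] by simp
  next
    case False
    then have cl: "closure {0..<s} = {0..s}" using limit by (simp add: closure_atLeastLessThan)
    have "norm (z s) - M * s \<le> 0"
    proof (rule continuous_le_on_closure[of "{0..<s}" "\<lambda>r. norm (z r) - M * r"])
      show "continuous_on (closure {0..<s}) (\<lambda>r. norm (z r) - M * r)"
        unfolding cl using limit by (intro continuous_intros sol_continuous_le[OF z]) auto
    qed (use limit cl in auto)
    then show ?thesis by simp
  qed
next
  case (step s)
  note c = local_dataD[OF ld]
  have "M * s \<le> M * a" using step b c by (intro mult_left_mono) auto
  then have "norm (z s) < \<delta>" using step(3)[of s] step(1) c(7) by (simp add: mult.commute)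
  then obtain e where e: "e > 0" "\<And>r. r \<in> {0..b} \<Longrightarrow> dist r s < e \<Longrightarrow> dist (z r) (z s) < \<delta> - norm (z s)"
    using sol_continuous[OF z] step(1,2) unfolding continuous_on_iff
    by (metis atLeastAtMost_iff diff_gt_0_iff_gt less_eq_real_def)
  have small: "norm (z u) \<le> \<delta>" if "0 \<le> u" "u < s + e" "u \<le> b" for u
  proof (cases "u \<le> s")
    case True
    have "M * u \<le> M * a" using True step b c by (intro mult_left_mono) auto
    then show ?thesis using step(3)[OF that(1) True] c(7) by (simp add: mult.commute)
  next
    case False
    then have "dist (z u) (z s) < \<delta> - norm (z s)" using that by (intro e) (auto simp: dist_norm)
    then show ?thesis using norm_triangle_sub[of "z u" "z s"] by (simp add: dist_norm)
  qed
  show ?case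
  proof (intro exI conjI allI impI)
    show "e > 0" by fact
    fix r assume r: "s < r" "r < s + e" "r \<le> b"
    show "norm (z r) \<le> M * r"
    proof (rule norm_has_integral_le[OF sol_integral_eq[OF z]])
      fix u assume "u \<in> {0..r}"
      then show "norm (F (state q z u)) \<le> M"
        using r b by (intro local_data_bound[OF ld q] sol_continuous_le[OF z] sol_zero[OF z] small) auto
    qed (use r step in auto)
  qed
qed

lemma sol_Lipschitz:
  assumes ld: "local_data p U a \<delta> M L" and q: "q \<in> U" and z: "sol q b z" and b: "b \<le> a"
    and s: "0 \<le> s" "s \<le> t" "t \<le> b"
  shows "norm (z t - z s) \<le> M * (t - s)"
proof -
  note c = local_dataD[OF ld]
  have small: "norm (z u) \<le> \<delta>" if "u \<in> {0..b}" for u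
  proof -
    have "M * u \<le> M * a" using that b c by (intro mult_left_mono) auto
    then show ?thesis using sol_growth[OF ld q z b that] c(7) by (simp add: mult.commute)
  qed
  have shifted: "sol (state q z s) (b - s) (\<lambda>u. z (s + u) - z s)"
    using s by (intro sol_shift[OF z]) auto
  have "norm (z (s + (t - s)) - z s) \<le> M * (t - s)"
  proof (rule norm_has_integral_le[OF sol_integral_eq[OF shifted]])
    fix u assume u: "u \<in> {0..t - s}"
    have "state (state q z s) (\<lambda>u. z (s + u) - z s) u = state q z (s + u)"
      using u s by (intro state_shifted_increment) auto
    then show "norm (F (state (state q z s) (\<lambda>u. z (s + u) - z s) u)) \<le> M"
      using u s b by (auto intro!: local_data_bound[OF ld q] sol_continuous_le[OF z] sol_zero[OF z] small)
  qed (use s in auto)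
  then show ?thesis by simp
qed

text \<open>
  Nearby initial points have no common Lipschitz constant, so Picard iteration gives no common interval
  of existence. Instead a solution is continued: it is \<open>M\<close>-Lipschitz, hence extends continuously
  to the end of its interval, where the state is still inside the rectangle and therefore in the domain,
  and local existence prolongs it further.
\<close>

lemma lifetime_lower_bound:
  assumes ld: "local_data p U a \<delta> M L" and q: "q \<in> U"
  shows "a \<in> lifetimes q"
proof -
  note c = local_dataD[OF ld]
  note qD = local_data_in_D[OF ld q]
  have "a \<in> {0..a}" using c by simp
  then show ?thesis
  proof (induction rule: real_interval_induct)
    case (limit s)
    show ?case
    proof (cases "s = 0")
      case True then show ?thesis using zero_in_lifetimes[OF qD] by simp
    next
      case False
      then have s: "0 < s" "s \<le> a" using limit by auto
      have cl: "closure {0..<s} = {0..s}" using s by (simp add: closure_atLeastLessThan)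
      have sl: "sol q r (increment q)" if "0 \<le> r" "r < s" for r
        using sol_increment[OF qD] limit that by blast
      have "M-lipschitz_on {0..<s} (increment q)"
      proof (rule lipschitz_onI)
        fix x y assume "x \<in> {0..<s}" "y \<in> {0..<s}"
        moreover have "norm (increment q y - increment q x) \<le> M * (y - x)" if "0 \<le> x" "x \<le> y" "y < s" for x y
          using that s by (intro sol_Lipschitz[OF ld q sl[of y]]) auto
        ultimately show "dist (increment q x) (increment q y) \<le> M * dist x y"
          by (cases "x \<le> y") (fastforce simp: dist_norm norm_minus_commute)+
      qed (use c in simp)
      then obtain g where g: "M-lipschitz_on {0..s} g" "\<And>r. r \<in> {0..<s} \<Longrightarrow> g r = increment q r"
        using lipschitz_extend_closure[of M "{0..<s}" "increment q"] cl by auto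
      have g0: "g 0 = 0" using g(2)[of 0] s increment_0[OF qD] by simp
      have gc: "continuous_on {0..s} g" using g(1) by (rule lipschitz_on_continuous_on)
      have small: "norm (g r) \<le> \<delta>" if "r \<in> {0..s}" for r
      proof -
        have "norm (g r) \<le> M * r"
          using lipschitz_onD[OF g(1), of r 0] that g0 by (simp add: dist_norm)
        also have "\<dots> \<le> M * a" using that s c by (intro mult_left_mono) auto
        finally show ?thesis using c(7) by (simp add: mult.commute)
      qed
      have gD: "state q g r \<in> D" if "r \<in> {0..s}" for r
        using that s by (intro local_data_bound[OF ld q] g0 small continuous_on_subset[OF gc]) auto
      have rate: "continuous_on {0..s} (\<lambda>r. F (state q g r))"
        using gD by (intro rate_continuous qD gc g0)
      have before: "g r - integral {0..r} (\<lambda>r. F (state q g r)) = 0" if r: "r \<in> {0..<s}" for r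
      proof -
        have "sol q r g" by (rule sol_cong[OF sl]) (use r g(2) in auto)
        then have "((\<lambda>r. F (state q g r)) has_integral g r) {0..r}"
          by (rule sol_integral_eq) (use r in auto)
        then show ?thesis by (simp add: integral_unique)
      qed
      have "g r - integral {0..r} (\<lambda>r. F (state q g r)) = 0" if r: "r \<in> {0..s}" for r
        using before
      proof (rule continuous_constant_on_closure[rotated])
        show "continuous_on (closure {0..<s}) (\<lambda>r. g r - integral {0..r} (\<lambda>r. F (state q g r)))"
          unfolding cl by (intro continuous_on_diff gc indefinite_integral_continuous_1 integrable_continuous_real rate)
      qed (use r cl in auto)
      then have "sol q s g" by (intro sol_from_integral_eq qD gc g0 gD) auto
      then show ?thesis using s by (intro lifetimesI) auto
    qed
  next
    case (step s)
    obtain e where e: "e > 0" "s + e \<in> lifetimes q"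
      using lifetimes_open[OF qD, of s] step by blast
    then show ?case
      using step by (intro exI[of _ e]) (auto intro: lifetimes_downward[OF e(2)])
  qed
qed

section \<open>Continuous dependence on the initial point\<close>

text \<open>
  The rate is jointly continuous in initial point, time and increment. As the relevant times and
  increments form a compact set, the tube lemma makes the continuity in the initial point uniform. This
  replaces the missing uniform Lipschitz constant.
\<close>

lemma uniform_rate_continuity:
  assumes ld: "local_data p U a \<delta> M L" and \<epsilon>: "0 < \<epsilon>"
  shows "\<forall>\<^sub>F q in nhdsin X p. q \<in> U \<and>
     (\<forall>r\<in>{0..a}. \<forall>z\<in>Lipschitz_increments M a. norm (F (state q (apply_bcontfun z) r) - F (state p (apply_bcontfun z) r)) < \<epsilon>)"
proof -
  note c = local_dataD[OF ld]
  have pD: "p \<in> D" by (rule local_data_in_D[OF ld c(2)])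
  define K :: "(real \<Rightarrow>\<^sub>C 'e) set" where "K = Lipschitz_increments M a"
  have K0: "apply_bcontfun z 0 = 0" and K\<delta>: "norm (apply_bcontfun z s) \<le> \<delta>" if "z \<in> K" for z s
  proof -
    show z0: "apply_bcontfun z 0 = 0" using that by (simp add: K_def Lipschitz_increments_def)
    have "norm (apply_bcontfun z s) = dist (apply_bcontfun z (max 0 (min s a))) (apply_bcontfun z 0)"
      using that unfolding z0 K_def Lipschitz_increments_def by simp
    also have "\<dots> \<le> M * dist (max 0 (min s a)) 0"
      using that unfolding K_def Lipschitz_increments_def by blast
    also have "\<dots> \<le> M * a" using c by (intro mult_left_mono) auto
    finally show "norm (apply_bcontfun z s) \<le> \<delta>" using c(7) by (simp add: mult.commute)
  qed
  have inD: "state q (apply_bcontfun z) r \<in> D" if "q \<in> U" "r \<in> {0..a}" "z \<in> K" for q r z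
    using that by (intro local_data_bound[OF ld] K0 K\<delta>) auto
  define Y where "Y = subtopology X U"
  define T where "T = top_of_set ({0..a} \<times> K)"
  define h where "h = (\<lambda>i. dist (F (state (fst i) (apply_bcontfun (snd (snd i))) (fst (snd i))))
                          (F (state p (apply_bcontfun (snd (snd i))) (fst (snd i)))))"
  have "continuous_map (prod_topology Y T) euclideanreal h"
  proof (rule continuous_map_limits)
    fix x assume x: "x \<in> topspace (prod_topology Y T)"
    obtain q0 r0 z0 where x_eq: "x = (q0, r0, z0)" by (cases x)
    have x0: "q0 \<in> U" "r0 \<in> {0..a}" "z0 \<in> K"
      using x by (auto simp: x_eq T_def Y_def)
    let ?\<F> = "nhdsin (prod_topology Y T) x"
    have lims: "limitin Y fst q0 ?\<F>" "limitin T snd (r0, z0) ?\<F>"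
      using limitin_nhdsin_self[OF x] unfolding limitin_pairwise by (auto simp: x_eq o_def)
    have q: "limitin X fst q0 ?\<F>" "\<forall>\<^sub>F i in ?\<F>. fst i \<in> U"
      using lims(1) unfolding Y_def by (auto simp: limitin_subtopology)
    have T: "(snd \<longlongrightarrow> (r0, z0)) ?\<F>" "\<forall>\<^sub>F i in ?\<F>. snd i \<in> {0..a} \<times> K"
      using lims(2) unfolding T_def by (auto simp: limitin_subtopology)
    have r: "((\<lambda>i. fst (snd i)) \<longlongrightarrow> r0) ?\<F>" and z: "((\<lambda>i. snd (snd i)) \<longlongrightarrow> z0) ?\<F>"
      using tendsto_fst[OF T(1)] tendsto_snd[OF T(1)] by simp_all
    have r_nn: "\<forall>\<^sub>F i in ?\<F>. 0 \<le> fst (snd i)" and z_0: "\<forall>\<^sub>F i in ?\<F>. apply_bcontfun (snd (snd i)) 0 = 0"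
      using T(2) by (eventually_elim, auto simp: K0)+
    have "((\<lambda>i. F (state (fst i) (apply_bcontfun (snd (snd i))) (fst (snd i)))) \<longlongrightarrow> F (state q0 (apply_bcontfun z0) r0)) ?\<F>"
    proof (intro F_limit state_limit q r z r_nn z_0)
      show "\<forall>\<^sub>F i in ?\<F>. state (fst i) (apply_bcontfun (snd (snd i))) (fst (snd i)) \<in> D"
        using q(2) T(2) by eventually_elim (auto intro!: inD)
    qed (use x0 in \<open>auto intro: K0 inD\<close>)
    moreover have "((\<lambda>i. F (state p (apply_bcontfun (snd (snd i))) (fst (snd i)))) \<longlongrightarrow> F (state p (apply_bcontfun z0) r0)) ?\<F>"
    proof (intro F_limit state_limit r z r_nn z_0)
      show "limitin X (\<lambda>i. p) p ?\<F>"
        by (rule Abstract_Limits.limitin_const_iff[THEN iffD2]) (simp only: topspace_X pD)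
      show "\<forall>\<^sub>F i in ?\<F>. state p (apply_bcontfun (snd (snd i))) (fst (snd i)) \<in> D"
        using T(2) by eventually_elim (auto intro!: inD c(2))
    qed (use x0 in \<open>auto intro: K0 inD c(2)\<close>)
    ultimately show "limitin euclideanreal h (h x) ?\<F>"
      by (simp add: h_def x_eq tendsto_dist)
  qed
  then have W: "openin (prod_topology Y T) {x \<in> topspace (prod_topology Y T). h x \<in> {..<\<epsilon>}}"
    by (rule openin_continuous_map_preimage) simp
  have cT: "compactin T ({0..a} \<times> K)"
    unfolding T_def K_def compactin_subtopology using compact_Lipschitz_increments[OF c(3,5)]
    by (auto intro!: compact_Times[OF compact_Icc])
  have pY: "p \<in> topspace Y"
    using c(2) pD topspace_X by (simp add: Y_def)
  have pW: "{p} \<times> ({0..a} \<times> K) \<subseteq> {x \<in> topspace (prod_topology Y T). h x \<in> {..<\<epsilon>}}"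
    using pY \<epsilon> by (auto simp: T_def h_def)
  obtain N V where N: "openin Y N" "openin T V" "p \<in> N" "{0..a} \<times> K \<subseteq> V"
    and NV: "N \<times> V \<subseteq> {x \<in> topspace (prod_topology Y T). h x \<in> {..<\<epsilon>}}"
    using tube_lemma_right[OF W cT pY pW] by (elim exE conjE) (rule that)
  have "openin X N" "N \<subseteq> U"
    using N(1) c(1) unfolding Y_def by (auto simp: openin_open_subtopology)
  moreover have "dist (F (state q (apply_bcontfun z) r)) (F (state p (apply_bcontfun z) r)) < \<epsilon>"
    if "q \<in> N" "r \<in> {0..a}" "z \<in> K" for q r z
  proof -
    have "(q, r, z) \<in> N \<times> V" using that N(4) by blast
    then have "h (q, r, z) < \<epsilon>" using NV by blast
    then show ?thesis by (simp add: h_def)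
  qed
  ultimately show ?thesis
    unfolding eventually_nhdsin K_def[symmetric] dist_norm[symmetric] using N(3) by blast
qed

text \<open>
  Continuous dependence at \<open>p\<close> up to time \<open>\<tau>\<close>, stated for the increments in \<open>E\<close> with the uniform norm
  rather than for the states in \<open>H\<close>: the uniform statement can be passed to left limits in \<open>\<tau>\<close>.
\<close>

definition depends_continuously :: "real \<times> (real \<Rightarrow> 'e) \<Rightarrow> real \<Rightarrow> bool" where
  "depends_continuously p \<tau> \<longleftrightarrow> (\<forall>\<epsilon>>0. \<forall>\<^sub>F q in nhdsin X p.
     q \<in> D \<and> \<tau> \<in> lifetimes q \<and> (\<forall>s\<in>{0..\<tau>}. norm (increment q s - increment p s) \<le> \<epsilon>))"

lemma depends_continuouslyD:
  assumes "depends_continuously p \<tau>" "0 < \<epsilon>"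
  shows "\<forall>\<^sub>F q in nhdsin X p. q \<in> D \<and> \<tau> \<in> lifetimes q \<and> (\<forall>s\<in>{0..\<tau>}. norm (increment q s - increment p s) \<le> \<epsilon>)"
  using assms by (simp add: depends_continuously_def)

lemma depends_continuously_mono:
  assumes "depends_continuously p \<tau>" "0 \<le> s" "s \<le> \<tau>"
  shows "depends_continuously p s"
  unfolding depends_continuously_def
proof (intro allI impI)
  fix \<epsilon> :: real assume "0 < \<epsilon>"
  from depends_continuouslyD[OF assms(1) this]
  show "\<forall>\<^sub>F q in nhdsin X p. q \<in> D \<and> s \<in> lifetimes q \<and> (\<forall>r\<in>{0..s}. norm (increment q r - increment p r) \<le> \<epsilon>)"
    by eventually_elim (use assms lifetimes_downward in auto)
qed

text \<open>
  For a nearby initial point \<open>q\<close>, the difference of the rates along the two solutions splits into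
  \<open>F (state q z r) - F (state p z r)\<close>, small uniformly in \<open>z\<close> by the tube lemma, and
  \<open>F (state p z r) - F (state p w r)\<close>, where the Lipschitz constant at \<open>p\<close> applies. With \<open>B\<close> the supremum of
  the difference of the increments this gives \<open>B \<le> \<epsilon> / 2 + B / 2\<close>.
\<close>

lemma depends_continuously_local:
  assumes ld: "local_data p U a \<delta> M L"
  shows "depends_continuously p a"
  unfolding depends_continuously_def
proof (intro allI impI)
  fix \<epsilon> :: real assume \<epsilon>: "0 < \<epsilon>"
  note c = local_dataD[OF ld]
  define \<eta> where "\<eta> = \<epsilon> / (2 * a)"
  have \<eta>: "0 < \<eta>" "a * \<eta> = \<epsilon> / 2" using \<epsilon> c by (auto simp: \<eta>_def)
  show "\<forall>\<^sub>F q in nhdsin X p. q \<in> D \<and> a \<in> lifetimes q \<and> (\<forall>s\<in>{0..a}. norm (increment q s - increment p s) \<le> \<epsilon>)"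
    using uniform_rate_continuity[OF ld \<eta>(1)]
  proof eventually_elim
    case (elim q)
    then have q: "q \<in> U" by blast
    define inc where "inc = (\<lambda>y. truncate a (increment y))"
    have U_facts: "y \<in> D" "a \<in> lifetimes y" "sol y a (increment y)" "inc y \<in> Lipschitz_increments M a"
      "continuous_on {0..a} (increment y)" "\<And>s. s \<in> {0..a} \<Longrightarrow> norm (increment y s) \<le> \<delta>" if "y \<in> U" for y
    proof -
      show yD: "y \<in> D" by (rule local_data_in_D[OF ld that])
      show ya: "a \<in> lifetimes y" by (rule lifetime_lower_bound[OF ld that])
      show sl: "sol y a (increment y)" by (rule sol_increment[OF yD ya])
      show cont: "continuous_on {0..a} (increment y)" by (rule sol_continuous[OF sl])
      show "inc y \<in> Lipschitz_increments M a"
        unfolding inc_def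
        by (rule truncate_Lipschitz_increments[OF _ _ cont sol_zero[OF sl] sol_Lipschitz[OF ld that sl order_refl]])
           (use c in auto)
      fix s assume s: "s \<in> {0..a}"
      have "norm (increment y s) \<le> M * s" by (rule sol_growth[OF ld that sl order_refl s])
      also have "\<dots> \<le> M * a" using s c by (intro mult_left_mono) auto
      finally show "norm (increment y s) \<le> \<delta>" using c(7) by (simp add: mult.commute)
    qed
    note uq = U_facts[OF q] and up = U_facts[OF c(2)]
    define B where "B = dist (inc q) (inc p)"
    have B: "norm (increment q s - increment p s) \<le> B" if "s \<in> {0..a}" for s
      using dist_bounded[of "inc q" s "inc p"] that c(3)
      by (simp add: inc_def truncate_apply uq(5) up(5) B_def dist_norm)
    have "B \<le> \<epsilon> / 2 + B / 2"
      unfolding B_def inc_def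
    proof (rule dist_truncate_le)
      fix s assume s: "s \<in> {0..a}"
      have "norm (increment q s - increment p s) \<le> (\<eta> + L * B) * s"
      proof (rule norm_has_integral_le)
        show "((\<lambda>r. F (flow r q) - F (flow r p)) has_integral increment q s - increment p s) {0..s}"
          using s by (intro has_integral_diff sol_integral_eq[OF uq(3)] sol_integral_eq[OF up(3)]) auto
        fix r assume "r \<in> {0..s}"
        then have r: "r \<in> {0..a}" using s by auto
        have tr: "state y (apply_bcontfun (inc q)) r = state y (increment q) r" for y
          unfolding inc_def using r by (intro state_truncate uq(5)) auto
        have "norm (F (flow r q) - F (state p (increment q) r)) < \<eta>"
          using elim r uq(4) tr by metis
        moreover have "norm (F (state p (increment q) r) - F (flow r p)) \<le> L * B"
          using r by (intro local_data_Lipschitz[OF ld] continuous_on_subset[OF uq(5)] continuous_on_subset[OF up(5)]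
              sol_zero[OF uq(3)] sol_zero[OF up(3)] uq(6) up(6) B) auto
        ultimately show "norm (F (flow r q) - F (flow r p)) \<le> \<eta> + L * B"
          using norm_diff_triangle_le less_imp_le by metis
      qed (use s in simp)
      also have "\<dots> \<le> (\<eta> + L * B) * a"
        using s c \<eta> by (intro mult_left_mono) (auto simp: B_def)
      also have "\<dots> \<le> \<epsilon> / 2 + B / 2"
        using mult_right_mono[OF c(8), of B] \<eta>(2) by (simp add: B_def algebra_simps)
      finally show "norm (increment q s - increment p s) \<le> \<epsilon> / 2 + dist (truncate a (increment q)) (truncate a (increment p)) / 2"
        by (simp add: B_def inc_def)
    qed (use c uq up in auto)
    then have "B \<le> \<epsilon>" by simp
    then show ?case using uq(1,2) order_trans[OF B] by blast
  qed
qed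

text \<open>
  Uniform closeness of the increments up to time \<open>\<tau>\<close> gives joint continuity of the flow there.
\<close>

lemma flow_limit:
  assumes p: "p \<in> D" and \<tau>: "\<tau> \<in> lifetimes p" and dep: "depends_continuously p \<tau>"
    and q: "limitin X q p \<F>"
    and r: "(r \<longlongrightarrow> r0) \<F>" "\<forall>\<^sub>F i in \<F>. r i \<in> {0..\<tau>}" "r0 \<in> {0..\<tau>}"
  shows "limitin X (\<lambda>i. flow (r i) (q i)) (flow r0 p) \<F>"
proof -
  have ev: "\<forall>\<^sub>F i in \<F>. q i \<in> D \<and> \<tau> \<in> lifetimes (q i) \<and> (\<forall>s\<in>{0..\<tau>}. norm (increment (q i) s - increment p s) \<le> \<epsilon>)"
    if "0 < \<epsilon>" for \<epsilon>
    using eventually_limitin_nhdsin[OF q depends_continuouslyD[OF dep that]] .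
  have \<tau>0: "0 \<le> \<tau>" using lifetimes_nonneg[OF \<tau>] .
  have cont: "continuous_on {0..\<tau>} (increment y)" if "y \<in> D" "\<tau> \<in> lifetimes y" for y
    by (rule sol_continuous[OF sol_increment[OF that]])
  have tr: "state y (apply_bcontfun (truncate \<tau> (increment y))) s = flow s y"
    if "y \<in> D" "\<tau> \<in> lifetimes y" "s \<in> {0..\<tau>}" for y s
    using that by (intro state_truncate cont) auto
  have "((\<lambda>i. truncate \<tau> (increment (q i))) \<longlongrightarrow> truncate \<tau> (increment p)) \<F>"
  proof (rule tendstoI)
    fix \<epsilon> :: real assume \<epsilon>: "0 < \<epsilon>"
    then have "0 < \<epsilon> / 2" by simp
    from ev[OF this] show "\<forall>\<^sub>F i in \<F>. dist (truncate \<tau> (increment (q i))) (truncate \<tau> (increment p)) < \<epsilon>"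
    proof eventually_elim
      case (elim i)
      then have "dist (truncate \<tau> (increment (q i))) (truncate \<tau> (increment p)) \<le> \<epsilon> / 2"
        by (intro dist_truncate_le \<tau>0 cont p \<tau>) auto
      then show ?case using \<epsilon> by simp
    qed
  qed
  then have "limitin X (\<lambda>i. state (q i) (apply_bcontfun (truncate \<tau> (increment (q i)))) (r i))
      (state p (apply_bcontfun (truncate \<tau> (increment p))) r0) \<F>"
  proof (intro state_limit q r(1))
    show "\<forall>\<^sub>F i in \<F>. 0 \<le> r i" using r(2) by eventually_elim simp
    show "\<forall>\<^sub>F i in \<F>. apply_bcontfun (truncate \<tau> (increment (q i))) 0 = 0"
      using ev[OF zero_less_one] by eventually_elim (use \<tau>0 in \<open>simp add: truncate_apply cont increment_0\<close>)
    show "\<forall>\<^sub>F i in \<F>. state (q i) (apply_bcontfun (truncate \<tau> (increment (q i)))) (r i) \<in> D"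
      using ev[OF zero_less_one] r(2)
      by eventually_elim (auto simp: tr intro!: flow_in_D intro: lifetimes_downward)
    show "state p (apply_bcontfun (truncate \<tau> (increment p))) r0 \<in> D"
      using r(3) by (auto simp: tr p \<tau> intro!: flow_in_D intro: lifetimes_downward[OF \<tau>])
  qed (use r(3) \<tau>0 in \<open>auto simp: truncate_apply cont increment_0 p \<tau>\<close>)
  moreover have "\<forall>\<^sub>F i in \<F>. state (q i) (apply_bcontfun (truncate \<tau> (increment (q i)))) (r i) = flow (r i) (q i)"
    using ev[OF zero_less_one] r(2) by eventually_elim (auto simp: tr)
  ultimately show ?thesis
    unfolding tr[OF p \<tau> r(3)] by (rule limitin_transform_eventually[rotated])
qed

lemma depends_continuously_add:
  assumes p: "p \<in> D" and c: "c \<in> lifetimes p" "depends_continuously p c"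
    and d: "d \<in> lifetimes (flow c p)" "depends_continuously (flow c p) d"
  shows "depends_continuously p (c + d)"
  unfolding depends_continuously_def
proof (intro allI impI)
  fix \<epsilon> :: real assume "0 < \<epsilon>"
  then have e2: "0 < \<epsilon> / 2" by simp
  have c0: "0 \<le> c" using lifetimes_nonneg[OF c(1)] .
  have "limitin X (\<lambda>q. flow c q) (flow c p) (nhdsin X p)"
    by (rule flow_limit[OF p c limitin_nhdsin_self]) (use p topspace_X c0 in auto)
  from eventually_limitin_nhdsin[OF this depends_continuouslyD[OF d(2) e2]] depends_continuouslyD[OF c(2) e2]
  show "\<forall>\<^sub>F q in nhdsin X p. q \<in> D \<and> c + d \<in> lifetimes q \<and> (\<forall>s\<in>{0..c + d}. norm (increment q s - increment p s) \<le> \<epsilon>)"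
  proof eventually_elim
    case (elim q)
    then have q: "q \<in> D" "c \<in> lifetimes q" "d \<in> lifetimes (flow c q)" by auto
    have "norm (increment q s - increment p s) \<le> \<epsilon>" if s: "s \<in> {0..c + d}" for s
    proof (cases "s \<le> c")
      case True
      then have "norm (increment q s - increment p s) \<le> \<epsilon> / 2" using elim s by auto
      then show ?thesis using e2 by simp
    next
      case False
      define u where "u = s - c"
      have u: "0 \<le> u" "u \<le> d" "s = c + u" using False s by (auto simp: u_def)
      have "increment q s = increment q c + increment (flow c q) u"
        unfolding u(3) by (rule lifetimes_add(2)[OF q(1,2) lifetimes_downward[OF q(3) u(1,2)]])
      moreover have "increment p s = increment p c + increment (flow c p) u"
        unfolding u(3) by (rule lifetimes_add(2)[OF p c(1) lifetimes_downward[OF d(1) u(1,2)]])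
      moreover have "norm (increment q c - increment p c) \<le> \<epsilon> / 2" "norm (increment (flow c q) u - increment (flow c p) u) \<le> \<epsilon> / 2"
        using elim c0 u by auto
      ultimately show ?thesis
        using norm_triangle_ineq[of "increment q c - increment p c" "increment (flow c q) u - increment (flow c p) u"]
        by (simp add: algebra_simps)
    qed
    then show ?case using q lifetimes_add(1)[OF q] by blast
  qed
qed

text \<open>
  Near the state at time \<open>s\<close> all solutions are \<open>M\<close>-Lipschitz on an interval of common length. Starting a
  little before \<open>s\<close> at a time \<open>r\<close> up to which continuous dependence is known, two solutions drift apart by
  at most \<open>2 * M * (s - r)\<close> until \<open>s\<close>.
\<close>

lemma depends_continuously_limit:
  assumes p: "p \<in> D" and s: "s \<in> lifetimes p"
    and before: "\<And>r. 0 \<le> r \<Longrightarrow> r < s \<Longrightarrow> depends_continuously p r"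
  shows "depends_continuously p s"
  unfolding depends_continuously_def
proof (intro allI impI)
  fix \<epsilon> :: real assume \<epsilon>: "0 < \<epsilon>"
  show "\<forall>\<^sub>F q in nhdsin X p. q \<in> D \<and> s \<in> lifetimes q \<and> (\<forall>r\<in>{0..s}. norm (increment q r - increment p r) \<le> \<epsilon>)"
  proof (cases "s = 0")
    case True
    have "\<forall>\<^sub>F q in nhdsin X p. q \<in> D"
      unfolding eventually_nhdsin using p topspace_X openin_topspace[of X] by blast
    then show ?thesis
      by eventually_elim (use True \<epsilon> p in \<open>auto simp: zero_in_lifetimes increment_0\<close>)
  next
    case False
    then have s0: "0 < s" using lifetimes_nonneg[OF s] by simp
    note end_D = flow_in_D[OF p s]
    obtain U a \<delta> M L where ld: "local_data (flow s p) U a \<delta> M L"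
      using local_data_exists[OF end_D] .
    note c = local_dataD[OF ld]
    note sl = sol_increment[OF p s]
    have "limitin X (\<lambda>r. flow r p) (flow s p) (at s within {0..s})"
      by (rule state_orbit_limit[OF p sol_continuous[OF sl] sol_zero[OF sl]])
         (use s0 sol_in_D[OF sl] in auto)
    from limitinD[OF this c(1,2)]
    obtain d where d: "d > 0" "\<And>r. r \<in> {0..s} \<Longrightarrow> r \<noteq> s \<Longrightarrow> dist r s < d \<Longrightarrow> flow r p \<in> U"
      unfolding eventually_at by blast
    \<comment> \<open>The orbit is in \<open>U\<close> at time \<open>s - h\<close>, solutions starting in \<open>U\<close> live for the time \<open>h\<close>,
       and each of them moves by at most \<open>M * h \<le> \<epsilon> / 4\<close> in it.\<close>
    define h where "h = min (d / 2) (min a (min s (\<epsilon> / (4 * M))))"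
    have h: "0 < h" "h < d" "h \<le> a" "h \<le> s" "h \<le> \<epsilon> / (4 * M)"
      using d c s0 \<epsilon> by (auto simp: h_def)
    then have hM: "M * h \<le> \<epsilon> / 4" using c by (simp add: field_simps)
    define r where "r = s - h"
    have r: "0 \<le> r" "r < s" "s = r + h" using h by (auto simp: r_def)
    have rU: "flow r p \<in> U" using r h by (intro d) (auto simp: dist_norm)
    have rl: "r \<in> lifetimes p" using lifetimes_downward[OF s] r by simp
    have "limitin X (\<lambda>q. flow r q) (flow r p) (nhdsin X p)"
      by (rule flow_limit[OF p rl before[OF r(1,2)] limitin_nhdsin_self]) (use p topspace_X r in auto)
    from limitinD[OF this c(1) rU] depends_continuouslyD[OF before[OF r(1,2)], of "\<epsilon> / 2"] \<epsilon>
    have "\<forall>\<^sub>F q in nhdsin X p. flow r q \<in> U \<and>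
        q \<in> D \<and> r \<in> lifetimes q \<and> (\<forall>s\<in>{0..r}. norm (increment q s - increment p s) \<le> \<epsilon> / 2)"
      by (auto intro: eventually_conj)
    then show ?thesis
    proof eventually_elim
      case (elim q)
      have after: "h \<in> lifetimes (flow r y)" "s \<in> lifetimes y"
        "\<And>u. 0 \<le> u \<Longrightarrow> u \<le> h \<Longrightarrow> increment y (r + u) = increment y r + increment (flow r y) u"
        "\<And>u. 0 \<le> u \<Longrightarrow> u \<le> h \<Longrightarrow> norm (increment (flow r y) u) \<le> \<epsilon> / 4"
        if y: "y \<in> D" "r \<in> lifetimes y" "flow r y \<in> U" for y
      proof -
        show hl: "h \<in> lifetimes (flow r y)"
          using lifetimes_downward[OF lifetime_lower_bound[OF ld y(3)]] h by simp
        show "s \<in> lifetimes y" unfolding r(3) by (rule lifetimes_add(1)[OF y(1,2) hl])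
        fix u assume u: "0 \<le> u" "u \<le> h"
        show "increment y (r + u) = increment y r + increment (flow r y) u"
          using lifetimes_add(2)[OF y(1,2) lifetimes_downward[OF hl u]] .
        have "sol (flow r y) h (increment (flow r y))"
          by (rule sol_increment[OF local_data_in_D[OF ld y(3)] hl])
        then have "norm (increment (flow r y) u) \<le> M * u"
          by (rule sol_growth[OF ld y(3) _ h(3)]) (simp add: u)
        also have "\<dots> \<le> M * h" using u c by (intro mult_left_mono) auto
        finally show "norm (increment (flow r y) u) \<le> \<epsilon> / 4" using hM by simp
      qed
      have q: "q \<in> D" "r \<in> lifetimes q" "flow r q \<in> U" using elim by auto
      have "norm (increment q v - increment p v) \<le> \<epsilon>" if v: "v \<in> {0..s}" for v
      proof (cases "v \<le> r")
        case True
        then have "norm (increment q v - increment p v) \<le> \<epsilon> / 2" using elim v by auto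
        then show ?thesis using \<epsilon> by simp
      next
        case False
        define u where "u = v - r"
        have u: "0 \<le> u" "u \<le> h" "v = r + u" using False v r by (auto simp: u_def)
        have "norm (increment q r - increment p r) \<le> \<epsilon> / 2" using elim r by auto
        moreover have "norm (increment (flow r q) u - increment (flow r p) u) \<le> \<epsilon> / 4 + \<epsilon> / 4"
          using norm_triangle_ineq4[of "increment (flow r q) u" "increment (flow r p) u"] after(4)[OF q u(1,2)] after(4)[OF p rl rU u(1,2)]
          by linarith
        moreover have "increment q v - increment p v = (increment q r - increment p r) + (increment (flow r q) u - increment (flow r p) u)"
          unfolding u(3) after(3)[OF q u(1,2)] after(3)[OF p rl rU u(1,2)] by simp
        ultimately show ?thesis
          using norm_triangle_ineq[of "increment q r - increment p r" "increment (flow r q) u - increment (flow r p) u"] by simp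
      qed
      then show ?case using q after(2)[OF q] by blast
    qed
  qed
qed

theorem continuous_dependence:
  assumes p: "p \<in> D" and b: "b \<in> lifetimes p"
  shows "depends_continuously p b"
proof -
  have "b \<in> {0..b}" using lifetimes_nonneg[OF b] by simp
  then show ?thesis
  proof (induction rule: real_interval_induct)
    case (limit s)
    have "s \<in> lifetimes p" by (rule lifetimes_downward[OF b]) (use limit in auto)
    from depends_continuously_limit[OF p this limit(2)] show ?case by blast
  next
    case (step s)
    have sl: "s \<in> lifetimes p" using step by (intro lifetimes_downward[OF b]) auto
    obtain U a \<delta> M L where ld: "local_data (flow s p) U a \<delta> M L"
      using local_data_exists[OF flow_in_D[OF p sl]] .
    note c = local_dataD[OF ld]
    have "depends_continuously p (s + a)"
      by (rule depends_continuously_add[OF p sl step(3) lifetime_lower_bound[OF ld c(2)] depends_continuously_local[OF ld]])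
         (use step in auto)
    then show ?case
      using c(3) step(1) by (intro exI[of _ a]) (auto intro: depends_continuously_mono)
  qed
qed

end

section \<open>Maximal solutions and the solution process\<close>

text \<open>
  The solution process agrees with the flow only on its domain, and its second argument is a pair
  that is taken apart and rebuilt.
\<close>

lemma continuous_maximal_semiflow_cong:
  fixes Y :: "'a topology"
  assumes "continuous_maximal_semiflow Y E \<Phi>" and eq: "\<And>c. c \<in> E \<Longrightarrow> \<Psi> c = \<Phi> c"
  shows "continuous_maximal_semiflow Y E \<Psi>"
proof -
  have sf: "maximal_semiflow Y E \<Phi>" and op: "openin (prod_topology (top_of_set {0..}) Y) E"
    and cont: "continuous_map (subtopology (prod_topology (top_of_set {0..}) Y) E) Y \<Phi>"
    using assms(1) by (auto simp: continuous_maximal_semiflow_def)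
  have zero: "(0, y) \<in> E" if "y \<in> topspace Y" for y
    using sf that unfolding maximal_semiflow_def by (auto simp: zero_ereal_def)
  have "maximal_semiflow Y E \<Psi>"
    unfolding maximal_semiflow_def
  proof (intro conjI ballI allI impI)
    show "\<Psi> \<in> E \<rightarrow> topspace Y" using sf eq by (auto simp: maximal_semiflow_def Pi_iff)
    show "\<exists>T :: 'a \<Rightarrow> ereal. (\<forall>x\<in>topspace Y. 0 < T x) \<and> E = {(t, x). x \<in> topspace Y \<and> 0 \<le> t \<and> ereal t < T x}"
      using sf unfolding maximal_semiflow_def by blast
    show "\<Psi> (0, y) = y" if "y \<in> topspace Y" for y
      using sf eq[OF zero[OF that]] that by (simp add: maximal_semiflow_def)
    fix t1 t2 y assume 1: "(t1, y) \<in> E" and 2: "(t2, \<Psi> (t1, y)) \<in> E"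
    then have "(t2, \<Phi> (t1, y)) \<in> E" by (simp add: eq)
    with 1 sf have *: "(t1 + t2, y) \<in> E \<and> \<Phi> (t1 + t2, y) = \<Phi> (t2, \<Phi> (t1, y))"
      unfolding maximal_semiflow_def by blast
    then show "(t1 + t2, y) \<in> E" by blast
    show "\<Psi> (t1 + t2, y) = \<Psi> (t2, \<Psi> (t1, y))" using * 1 2 eq by simp
  qed
  moreover have "continuous_map (subtopology (prod_topology (top_of_set {0..}) Y) E) Y \<Psi>"
    by (rule continuous_map_eq[OF cont]) (simp add: eq)
  ultimately show ?thesis using op by (simp add: continuous_maximal_semiflow_def)
qed

context retarded_ivp
begin

definition lifespan :: "real \<times> (real \<Rightarrow> 'e) \<Rightarrow> ereal" where
  "lifespan p = (SUP b\<in>lifetimes p. ereal b)"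

lemma lifetimes_iff:
  assumes p: "p \<in> D"
  shows "b \<in> lifetimes p \<longleftrightarrow> 0 \<le> b \<and> ereal b < lifespan p"
proof
  assume b: "b \<in> lifetimes p"
  obtain e where e: "e > 0" "b + e \<in> lifetimes p" using lifetimes_open[OF p b] .
  have "ereal b < ereal (b + e)" using e by simp
  also have "\<dots> \<le> lifespan p" unfolding lifespan_def by (rule SUP_upper[OF e(2)])
  finally show "0 \<le> b \<and> ereal b < lifespan p" using lifetimes_nonneg[OF b] by simp
next
  assume b: "0 \<le> b \<and> ereal b < lifespan p"
  then obtain c where "c \<in> lifetimes p" "b < c"
    unfolding lifespan_def less_SUP_iff by auto
  then show "b \<in> lifetimes p" using b lifetimes_downward by auto
qed

lemma lifespan_pos: "p \<in> D \<Longrightarrow> 0 < lifespan p"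
  using lifetimes_iff[of p 0] zero_in_lifetimes[of p] by (simp add: zero_ereal_def)

definition max_interval :: "real \<times> (real \<Rightarrow> 'e) \<Rightarrow> real set" where
  "max_interval p = {t. fst p \<le> t \<and> ereal t < ereal (fst p) + lifespan p}"

lemma max_interval_iff:
  assumes p: "p \<in> D"
  shows "t \<in> max_interval p \<longleftrightarrow> t - fst p \<in> lifetimes p"
  unfolding max_interval_def lifetimes_iff[OF p]
  by (cases "lifespan p") auto

definition max_solution :: "real \<times> (real \<Rightarrow> 'e) \<Rightarrow> real \<Rightarrow> 'e" where
  "max_solution p = (\<lambda>t\<in>max_interval p + I. snd p (min (t - fst p) 0) + increment p (max (t - fst p) 0))"

lemma shift_map_max_solution:
  assumes "t \<in> max_interval p"
  shows "shift_map I t (max_solution p) = evolve I (t - fst p) (snd p) (increment p)"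
proof (rule extensionalityI[of _ I])
  fix \<theta> assume th: "\<theta> \<in> I"
  then have "t + \<theta> \<in> max_interval p + I" using assms by (intro set_plus_intro)
  then show "shift_map I t (max_solution p) \<theta> = evolve I (t - fst p) (snd p) (increment p) \<theta>"
    using th by (simp add: shift_map_def max_solution_def evolve_def algebra_simps)
qed (auto simp: shift_map_def evolve_def)

lemma max_solution_flow:
  assumes "p \<in> D" "\<tau> \<in> lifetimes p"
  shows "(fst p + \<tau>, shift_map I (fst p + \<tau>) (max_solution p)) = flow \<tau> p"
proof -
  have "fst p + \<tau> \<in> max_interval p" using assms by (simp add: max_interval_iff)
  from shift_map_max_solution[OF this] show ?thesis by (simp add: state_def)
qed

text \<open>
  Splits a solution on \<open>J + I\<close> into its history before \<open>t\<^sub>0\<close> and its increment afterwards.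
\<close>

lemma ivp_solution_eq:
  assumes sol: "ivp_solution I D F (fst p) (snd p) J x" and t: "t \<in> J + I"
  shows "x t = snd p (min (t - fst p) 0) + (x (fst p + max (t - fst p) 0) - snd p 0)"
proof -
  have past_val: "x (fst p + \<theta>) = snd p \<theta>" if "\<theta> \<in> I" for \<theta>
    using sol that unfolding ivp_solution_def shift_map_def by (metis restrict_apply')
  obtain j \<theta> where j: "j \<in> J" "\<theta> \<in> I" "t = j + \<theta>" using t by (auto elim: set_plus_elim)
  have "fst p \<le> j" using sol j(1) by (auto simp: ivp_solution_def interval_from_def)
  show ?thesis
  proof (cases "t \<le> fst p")
    case True
    then have "t - fst p \<in> I"
      using past_interval_between[OF past j(2), of "t - fst p"] j(3) \<open>fst p \<le> j\<close> by simp
    then show ?thesis using past_val[of "t - fst p"] past_val[OF zero_in_past_interval[OF past]] True by simp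
  qed (simp)
qed

lemma ivp_solution_imp_sol:
  assumes sol: "ivp_solution I D F (fst p) (snd p) J x" and b: "fst p + b \<in> J"
  shows "sol p b (\<lambda>s. x (fst p + s) - snd p 0)" (is "sol p b ?z")
proof -
  have J: "is_interval J" "fst p \<in> J" "J \<subseteq> {fst p..}"
    using sol by (auto simp: ivp_solution_def interval_from_def)
  have x0: "x (fst p) = snd p 0"
    using sol zero_in_past_interval[OF past] unfolding ivp_solution_def shift_map_def
    by (metis add_0_right restrict_apply')
  show ?thesis
    unfolding sol_def
  proof (intro conjI ballI)
    show "?z 0 = 0" by (simp add: x0)
    fix s assume s: "s \<in> {0..b}"
    have sJ: "fst p + s \<in> J"
      using J b s unfolding is_interval_1 by (metis add.commute add_le_cancel_left atLeastAtMost_iff le_add_same_cancel1)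
    have "shift_map I (fst p + s) x = evolve I s (snd p) ?z"
    proof (rule extensionalityI[of _ I])
      fix \<theta> assume th: "\<theta> \<in> I"
      have "fst p + s + \<theta> \<in> J + I" using sJ th by (intro set_plus_intro)
      from ivp_solution_eq[OF sol this]
      show "shift_map I (fst p + s) x \<theta> = evolve I s (snd p) ?z \<theta>"
        using th by (simp add: shift_map_def evolve_def algebra_simps)
    qed (auto simp: shift_map_def evolve_def)
    then have st: "state p ?z s = (fst p + s, shift_map I (fst p + s) x)"
      by (simp add: state_def)
    show "state p ?z s \<in> D" unfolding st using sol sJ by (simp add: ivp_solution_def)
    have "(x has_vector_derivative F (state p ?z s)) (at (fst p + s) within J)"
      unfolding st using sol sJ by (simp add: ivp_solution_def)
    moreover have "(+) (fst p) ` {0..b} \<subseteq> J"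
      using J b unfolding is_interval_1
      by (smt (verit, best) atLeastAtMost_iff image_subset_iff)
    ultimately have "(x has_vector_derivative F (state p ?z s)) (at (fst p + s) within (+) (fst p) ` {0..b})"
      by (rule has_vector_derivative_within_subset)
    moreover have "((+) (fst p) has_vector_derivative 1) (at s within {0..b})"
      by (auto intro!: derivative_eq_intros)
    ultimately have "((x \<circ> (+) (fst p)) has_vector_derivative 1 *\<^sub>R F (state p ?z s)) (at s within {0..b})"
      by (intro vector_diff_chain_within)
    then show "(?z has_vector_derivative F (state p ?z s)) (at s within {0..b})"
      by (auto intro!: derivative_eq_intros simp: o_def)
  qed
qed

text \<open>
  Every solution, of class \<open>C\<^sup>1\<close> or not, is a restriction of one and the same solution; this makes the
  maximal solution unique.
\<close>

lemma ivp_solution_below_max: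
  assumes p: "p \<in> D" and sol: "ivp_solution I D F (fst p) (snd p) J x"
  shows "J \<subseteq> max_interval p" "\<And>t. t \<in> J + I \<Longrightarrow> x t = max_solution p t"
proof -
  have J: "is_interval J" "fst p \<in> J" "J \<subseteq> {fst p..}"
    using sol by (auto simp: ivp_solution_def interval_from_def)
  have sol_t: "sol p (t - fst p) (\<lambda>s. x (fst p + s) - snd p 0)" if "t \<in> J" for t
    using that by (intro ivp_solution_imp_sol[OF sol]) simp
  show sub: "J \<subseteq> max_interval p"
  proof
    fix t assume t: "t \<in> J"
    then show "t \<in> max_interval p"
      unfolding max_interval_iff[OF p] using J(3) by (intro lifetimesI[OF sol_t]) auto
  qed
  fix t assume t: "t \<in> J + I"
  then obtain j \<theta> where j: "j \<in> J" "\<theta> \<in> I" "t = j + \<theta>" by (auto elim: set_plus_elim)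
  have "increment p (max (t - fst p) 0) = x (fst p + max (t - fst p) 0) - snd p 0"
    using past_interval_nonpos[OF past j(2)] j(1,3) J(3)
    by (intro increment_eq[OF p sol_t[OF j(1)]]) auto
  moreover have "t \<in> max_interval p + I"
    using sub j by (auto intro: set_plus_intro)
  ultimately show "x t = max_solution p t"
    using ivp_solution_eq[OF sol t] by (simp add: max_solution_def)
qed

lemma max_solution_C1:
  assumes p: "p \<in> D"
  shows "C1_solution I D F (fst p) (snd p) (max_interval p) (max_solution p)"
proof -
  let ?J = "max_interval p" and ?x = "max_solution p"
  let ?f = "\<lambda>t. F (flow (t - fst p) p)"
  note J_iff = max_interval_iff[OF p]
  have flow_t: "(t, shift_map I t ?x) = flow (t - fst p) p" if "t \<in> ?J" for t
    using shift_map_max_solution[OF that] by (simp add: state_def)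
  have x_eq: "?x t = snd p 0 + increment p (t - fst p)" if "t \<in> ?J" for t
  proof -
    have "t \<in> ?J + I"
      using set_plus_intro[OF that zero_in_past_interval[OF past]] by simp
    then show ?thesis using that by (simp add: max_solution_def max_interval_def)
  qed
  \<comment> \<open>Derivatives and limits within \<open>max_interval p\<close> may be taken within a compact subinterval that
     reaches beyond \<open>t\<close>, since no lifetime is the largest one.\<close>
  have near: "\<exists>b. b \<in> lifetimes p \<and> t \<in> {fst p..fst p + b} \<and> at t within ?J = at t within {fst p..fst p + b}"
    if t: "t \<in> ?J" for t
  proof -
    obtain e where e: "e > 0" "t - fst p + e \<in> lifetimes p"
      using lifetimes_open[OF p] t J_iff by blast
    define b where "b = t - fst p + e"
    have "at t within ?J = at t within {fst p..fst p + b}"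
    proof (rule at_within_nhd[of t "{..<fst p + b}"])
      show "?J \<inter> {..<fst p + b} - {t} = {fst p..fst p + b} \<inter> {..<fst p + b} - {t}"
        using lifetimes_downward[OF e(2)] lifetimes_nonneg[of _ p] by (fastforce simp: J_iff b_def)
    qed (use e in \<open>auto simp: b_def\<close>)
    then show ?thesis
      using e t J_iff lifetimes_nonneg[of "t - fst p" p] by (intro exI[of _ b]) (auto simp: b_def)
  qed
  have inJ: "s \<in> ?J" if "b \<in> lifetimes p" "s \<in> {fst p..fst p + b}" for s b
    using lifetimes_downward[OF that(1), of "s - fst p"] that(2) J_iff by auto
  have deriv: "(?x has_vector_derivative ?f t) (at t within ?J)" if t: "t \<in> ?J" for t
  proof -
    obtain b where b: "b \<in> lifetimes p" "t \<in> {fst p..fst p + b}" "at t within ?J = at t within {fst p..fst p + b}"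
      using near[OF t] by blast
    have "(increment p has_vector_derivative ?f t) (at (t - fst p) within (\<lambda>t. t - fst p) ` {fst p..fst p + b})"
      using b(2) by (intro sol_derivative[OF sol_increment[OF p b(1)]]) auto
    moreover have "((\<lambda>t. t - fst p) has_vector_derivative 1) (at t within {fst p..fst p + b})"
      by (auto intro!: derivative_eq_intros)
    ultimately have "((increment p \<circ> (\<lambda>t. t - fst p)) has_vector_derivative 1 *\<^sub>R ?f t) (at t within {fst p..fst p + b})"
      by (intro vector_diff_chain_within)
    then have "((\<lambda>t. snd p 0 + increment p (t - fst p)) has_vector_derivative ?f t) (at t within {fst p..fst p + b})"
      by (auto intro!: derivative_eq_intros simp: o_def)
    then have "(?x has_vector_derivative ?f t) (at t within {fst p..fst p + b})"
      by (rule has_vector_derivative_transform[OF b(2), rotated]) (simp add: x_eq inJ[OF b(1)])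
    then show ?thesis by (simp add: b(3))
  qed
  have cont: "continuous_on ?J ?f"
    unfolding continuous_on_def
  proof
    fix t assume t: "t \<in> ?J"
    obtain b where b: "b \<in> lifetimes p" "t \<in> {fst p..fst p + b}" "at t within ?J = at t within {fst p..fst p + b}"
      using near[OF t] by blast
    note sl = sol_increment[OF p b(1)]
    have "continuous_on {0..b} (\<lambda>s. F (flow s p))"
      by (rule rate_continuous[OF p sol_continuous[OF sl] sol_zero[OF sl]]) (use sol_in_D[OF sl] in auto)
    then have "continuous_on {fst p..fst p + b} ?f"
      by (rule continuous_on_compose2) (auto intro!: continuous_intros)
    then show "(?f \<longlongrightarrow> ?f t) (at t within ?J)"
      unfolding b(3) continuous_on_def using b(2) by blast
  qed
  have start: "fst p \<in> ?J" using zero_in_lifetimes[OF p] J_iff by simp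
  have "ivp_solution I D F (fst p) (snd p) ?J ?x"
    unfolding ivp_solution_def
  proof (intro conjI ballI)
    show "interval_from (fst p) ?J"
      unfolding interval_from_def is_interval_1
    proof (intro conjI ballI allI impI)
      fix a b t assume "a \<in> ?J" "b \<in> ?J" "a \<le> t \<and> t \<le> b"
      then show "t \<in> ?J"
        using lifetimes_downward[of "b - fst p" p "t - fst p"] lifetimes_nonneg[of "a - fst p" p] J_iff by auto
    qed (use start in \<open>auto simp: max_interval_def\<close>)
    obtain e where "e > 0" "0 + e \<in> lifetimes p" using lifetimes_open[OF p zero_in_lifetimes[OF p]] .
    then have "fst p + e \<in> ?J" "fst p + e \<noteq> fst p" using J_iff by auto
    then show "?J \<noteq> {fst p}" by blast
    show "?x \<in> extensional (?J + I)" by (simp add: max_solution_def)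
    show "shift_map I (fst p) ?x = snd p"
      using flow_t[OF start] flow_0[OF p] by (metis diff_self snd_conv)
    show "(t, shift_map I t ?x) \<in> D" if "t \<in> ?J" for t
      using flow_t[OF that] flow_in_D[OF p] that J_iff by metis
    show "(?x has_vector_derivative F (t, shift_map I t ?x)) (at t within ?J)" if "t \<in> ?J" for t
      unfolding flow_t[OF that] by (rule deriv[OF that])
  qed
  moreover have "C1_on ?J ?x" 
    unfolding C1_on_def by (intro exI[of _ ?f] conjI ballI deriv cont)
  ultimately show ?thesis by (simp add: C1_solution_def)
qed

lemma maximal_C1_solution_iff:
  assumes p: "p \<in> D"
  shows "maximal_C1_solution I D F (fst p) (snd p) J x \<longleftrightarrow> J = max_interval p \<and> x = max_solution p"
proof -
  have le: "sol_le (J, x) (max_interval p, max_solution p)" and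
    eq: "max_interval p \<subseteq> J \<Longrightarrow> J = max_interval p \<and> x = max_solution p"
    if "C1_solution I D F (fst p) (snd p) J x" for J x
  proof -
    have sol: "ivp_solution I D F (fst p) (snd p) J x" using that by (simp add: C1_solution_def)
    note below = ivp_solution_below_max[OF p sol]
    have "t \<in> J + I" if "t \<in> J" for t
      using set_plus_intro[OF that zero_in_past_interval[OF past]] by simp
    then show "sol_le (J, x) (max_interval p, max_solution p)"
      using below by (simp add: sol_le_def)
    assume "max_interval p \<subseteq> J"
    then have J: "J = max_interval p" using below(1) by blast
    moreover have "x = max_solution p"
    proof (rule extensionalityI[of _ "J + I"])
      show "x \<in> extensional (J + I)" using sol by (simp add: ivp_solution_def)
      show "max_solution p \<in> extensional (J + I)" by (simp add: J max_solution_def)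
    qed (rule below(2))
    ultimately show "J = max_interval p \<and> x = max_solution p" by blast
  qed
  show ?thesis
  proof
    assume "maximal_C1_solution I D F (fst p) (snd p) J x"
    then have "C1_solution I D F (fst p) (snd p) J x" and
      "sol_le (J, x) (max_interval p, max_solution p) \<Longrightarrow> (max_interval p, max_solution p) = (J, x)"
      using max_solution_C1[OF p] unfolding maximal_C1_solution_def by blast+
    from this(2)[OF le[OF this(1)]] show "J = max_interval p \<and> x = max_solution p" by simp
  next
    assume "J = max_interval p \<and> x = max_solution p"
    moreover have "(J', x') = (max_interval p, max_solution p)"
      if "C1_solution I D F (fst p) (snd p) J' x'" "sol_le (max_interval p, max_solution p) (J', x')" for J' x'
      using eq[OF that(1)] that(2) by (simp add: sol_le_def)
    ultimately show "maximal_C1_solution I D F (fst p) (snd p) J x"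
      unfolding maximal_C1_solution_def using max_solution_C1[OF p] by blast
  qed
qed

definition flow_domain :: "(real \<times> real \<times> (real \<Rightarrow> 'e)) set" where
  "flow_domain = {(\<tau>, p). p \<in> D \<and> \<tau> \<in> lifetimes p}"

text \<open>
  At a slightly later time than \<open>\<tau>\<close> the solution from \<open>p\<close> still exists, and continuous dependence up to
  that time includes the existence of the nearby solutions.
\<close>

lemma openin_flow_domain: "openin (prod_topology (top_of_set {0..}) X) flow_domain"
proof (subst openin_subopen, intro ballI)
  fix c assume "c \<in> flow_domain"
  then obtain \<tau> p where c: "c = (\<tau>, p)" and p: "p \<in> D" and \<tau>: "\<tau> \<in> lifetimes p"
    by (auto simp: flow_domain_def)
  obtain e where e: "e > 0" "\<tau> + e \<in> lifetimes p" using lifetimes_open[OF p \<tau>] .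
  obtain U where U: "openin X U" "p \<in> U" "\<And>q. q \<in> U \<Longrightarrow> q \<in> D \<and> \<tau> + e \<in> lifetimes q"
    using depends_continuouslyD[OF continuous_dependence[OF p e(2)] zero_less_one] p topspace_X
    unfolding eventually_nhdsin by blast
  let ?N = "({0..} \<inter> {..<\<tau> + e}) \<times> U"
  have "openin (prod_topology (top_of_set {0..}) X) ?N"
    using U(1) by (simp add: openin_prod_Times_iff openin_open_Int)
  moreover have "c \<in> ?N" using lifetimes_nonneg[OF \<tau>] e U by (simp add: c)
  moreover have "?N \<subseteq> flow_domain"
    unfolding flow_domain_def using U(3) lifetimes_downward by fastforce
  ultimately show "\<exists>N. openin (prod_topology (top_of_set {0..}) X) N \<and> c \<in> N \<and> N \<subseteq> flow_domain"
    by blast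
qed

lemma flow_continuous:
  "continuous_map (subtopology (prod_topology (top_of_set {0..}) X) flow_domain) X (\<lambda>(\<tau>, p). flow \<tau> p)"
proof (rule continuous_map_limits)
  let ?Y = "subtopology (prod_topology (top_of_set {0..}) X) flow_domain"
  fix c assume c: "c \<in> topspace ?Y"
  then obtain \<tau> p where c_eq: "c = (\<tau>, p)" and p: "p \<in> D" and \<tau>: "\<tau> \<in> lifetimes p"
    by (auto simp: flow_domain_def)
  obtain e where e: "e > 0" "\<tau> + e \<in> lifetimes p" using lifetimes_open[OF p \<tau>] .
  have lims: "limitin (top_of_set {0..}) fst \<tau> (nhdsin ?Y c)" "limitin X snd p (nhdsin ?Y c)"
    using limitin_nhdsin_self[OF c] unfolding limitin_subtopology[of "prod_topology _ _"] limitin_pairwise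
    by (auto simp: c_eq o_def)
  have r: "(fst \<longlongrightarrow> \<tau>) (nhdsin ?Y c)" "\<forall>\<^sub>F i in nhdsin ?Y c. 0 \<le> fst i"
    using lims(1) unfolding limitin_nonneg_reals by auto
  have "\<forall>\<^sub>F i in nhdsin ?Y c. fst i < \<tau> + e"
    using r(1) by (rule order_tendstoD) (use e in simp)
  with r(2) have "\<forall>\<^sub>F i in nhdsin ?Y c. fst i \<in> {0..\<tau> + e}"
    by eventually_elim simp
  from flow_limit[OF p e(2) continuous_dependence[OF p e(2)] lims(2) r(1) this]
  show "limitin X (\<lambda>(\<tau>, p). flow \<tau> p) ((\<lambda>(\<tau>, p). flow \<tau> p) c) (nhdsin ?Y c)"
    using lifetimes_nonneg[OF \<tau>] e(1) by (simp add: c_eq case_prod_beta')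
qed

lemma flow_semiflow: "maximal_semiflow X flow_domain (\<lambda>(\<tau>, p). flow \<tau> p)"
  unfolding maximal_semiflow_def topspace_X
proof (intro conjI ballI allI impI)
  show "(\<lambda>(\<tau>, p). flow \<tau> p) \<in> flow_domain \<rightarrow> D"
    using flow_in_D by (auto simp: flow_domain_def simp del: split_paired_All)
  show "\<exists>T :: real \<times> (real \<Rightarrow> 'e) \<Rightarrow> ereal. (\<forall>p\<in>D. 0 < T p) \<and>
      flow_domain = {(t, p). p \<in> D \<and> 0 \<le> t \<and> ereal t < T p}"
    by (rule exI[of _ lifespan]) (use lifespan_pos lifetimes_iff in \<open>auto simp: flow_domain_def\<close>)
  show "(case (0, p) of (\<tau>, p) \<Rightarrow> flow \<tau> p) = p" if "p \<in> D" for p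
    using flow_0[OF that] by simp
  fix t1 t2 p assume 1: "(t1, p) \<in> flow_domain" and 2: "(t2, (\<lambda>(\<tau>, p). flow \<tau> p) (t1, p)) \<in> flow_domain"
  have p: "p \<in> D" "t1 \<in> lifetimes p" "t2 \<in> lifetimes (flow t1 p)"
    using 1 2 by (auto simp: flow_domain_def)
  show "(t1 + t2, p) \<in> flow_domain" using lifetimes_add(1)[OF p] p(1) by (simp add: flow_domain_def)
  show "(\<lambda>(\<tau>, p). flow \<tau> p) (t1 + t2, p) = (\<lambda>(\<tau>, p). flow \<tau> p) (t2, (\<lambda>(\<tau>, p). flow \<tau> p) (t1, p))"
    using lifetimes_add(3)[OF p] by simp
qed

theorem maximally_well_posed: "maximally_well_posed_C1 I H D F"
  unfolding maximally_well_posed_C1_def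
proof (intro exI conjI)
  show "\<forall>(t, \<phi>)\<in>D. 0 < lifespan (t, \<phi>) \<and>
      (\<forall>J x. maximal_C1_solution I D F t \<phi> J x \<longleftrightarrow>
         J = {s. t \<le> s \<and> ereal s < ereal t + lifespan (t, \<phi>)} \<and> x = max_solution (t, \<phi>))"
  proof (intro ballI, clarify, intro conjI allI)
    fix t \<phi> J x assume p: "(t, \<phi>) \<in> D"
    show "0 < lifespan (t, \<phi>)" by (rule lifespan_pos[OF p])
    show "maximal_C1_solution I D F t \<phi> J x \<longleftrightarrow>
         J = {s. t \<le> s \<and> ereal s < ereal t + lifespan (t, \<phi>)} \<and> x = max_solution (t, \<phi>)"
      using maximal_C1_solution_iff[OF p, of J x] unfolding max_interval_def by simp
  qed
  have dom: "{(\<tau>, (t, \<phi>)). (t, \<phi>) \<in> D \<and> 0 \<le> \<tau> \<and> ereal \<tau> < lifespan (t, \<phi>)} = flow_domain"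
    using lifetimes_iff by (auto simp: flow_domain_def)
  show "continuous_maximal_process H D
      {(\<tau>, (t, \<phi>)). (t, \<phi>) \<in> D \<and> 0 \<le> \<tau> \<and> ereal \<tau> < lifespan (t, \<phi>)}
      (\<lambda>(\<tau>, (t, \<phi>)). shift_map I (t + \<tau>) (max_solution (t, \<phi>)))"
    unfolding continuous_maximal_process_def dom
  proof (rule continuous_maximal_semiflow_cong)
    show "continuous_maximal_semiflow X flow_domain (\<lambda>(\<tau>, p). flow \<tau> p)"
      unfolding continuous_maximal_semiflow_def
      by (intro conjI flow_semiflow openin_flow_domain flow_continuous)
    fix c assume "c \<in> flow_domain"
    then show "(case c of (\<tau>, t, \<phi>) \<Rightarrow> (t + \<tau>, case (\<tau>, t, \<phi>) of (\<tau>, t, \<phi>) \<Rightarrow>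
        shift_map I (t + \<tau>) (max_solution (t, \<phi>)))) = (case c of (\<tau>, p) \<Rightarrow> flow \<tau> p)"
      using max_solution_flow by (auto simp: flow_domain_def simp del: split_paired_All)
  qed
qed

end

theorem theorem4:
  fixes I :: "real set"
    and H :: "(real \<Rightarrow> real ^ 'n) topology"
    and D :: "(real \<times> (real \<Rightarrow> real ^ 'n)) set"
    and F :: "real \<times> (real \<Rightarrow> real ^ 'n) \<Rightarrow> real ^ 'n"
  assumes "past_interval I"
    and "history_space I H"
    and "D \<subseteq> UNIV \<times> topspace H"
    and "prolongable I H"
    and "regulated_by_prolongations I H"
    and "continuous_map (subtopology (prod_topology euclideanreal H) D) euclidean F"
    and "\<forall>(t\<^sub>0, \<phi>\<^sub>0)\<in>D. uniform_nbhd_by_prolongations I H D t\<^sub>0 \<phi>\<^sub>0"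
    and "locally_Lipschitzian_about_prolongations I D F"
    and "continuous_map (prod_topology (top_of_set {0..}) H) H (\<lambda>(t, \<phi>). S0 I t \<phi>)"
  shows "maximally_well_posed_C1 I H D F"
proof -
  interpret retarded_ivp I H D F
    by (rule retarded_ivp.intro) (fact assms)+
  show ?thesis by (rule maximally_well_posed)
qed

end
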